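(* Let $\delta_1$ denote the supremum of all numbers $\delta>0$ with the following property: every function $f\in\mathcal{A}$ satisfying $L(f)\le e^{\delta} l(f)$ is univalent on $\mathbb{D}$. Then $$\frac{7\pi}{25}<\delta_1<\frac{5\pi}{7}.$$
   Context: $\mathbb{D}=\{z\in\mathbb{C}:|z|<1\}$. $\mathcal{A}$ denotes the class of analytic functions $f$ on $\mathbb{D}$ normalized by $f(0)=0$, $f'(0)=1$. The value of $zf'(z)/f(z)$ at $z=0$ is understood as $1$. For $f\in\mathcal{A}$, $L(f)=\sup_{z\in\mathbb{D}}|zf'(z)/f(z)|$ and $l(f)=\inf_{z\in\mathbb{D}}|zf'(z)/f(z)|$ (so $0\le l(f)\le 1\le L(f)\le+\infty$). *)

theory Defs
  imports "HOL-Complex_Analysis.Complex_Analysis" "HOL-Library.Extended_Real"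
begin

definition classA :: "(complex \<Rightarrow> complex) set" where
  "classA = {f. f holomorphic_on ball 0 1 \<and> f 0 = 0 \<and> deriv f 0 = 1}"

definition zq :: "(complex \<Rightarrow> complex) \<Rightarrow> complex \<Rightarrow> complex" where
  "zq f z = (if z = 0 then 1 else z * deriv f z / f z)"

text \<open>Points of the disc where z f'(z)/f(z) is defined (at zeros of f away from 0
  it has a pole, i.e. the modulus is +infinity; these points do not change the
  supremum, which is then +infinity anyway, and they are excluded from the infimum).\<close>
definition dom_q :: "(complex \<Rightarrow> complex) \<Rightarrow> complex set" where
  "dom_q f = {z \<in> ball 0 1. z = 0 \<or> f z \<noteq> 0}"

definition Lf :: "(complex \<Rightarrow> complex) \<Rightarrow> ereal" where
  "Lf f = (SUP z \<in> dom_q f. ereal (cmod (zq f z)))"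

definition lf :: "(complex \<Rightarrow> complex) \<Rightarrow> ereal" where
  "lf f = (INF z \<in> dom_q f. ereal (cmod (zq f z)))"

definition delta1 :: ereal where
  "delta1 = Sup {ereal \<delta> | \<delta>. \<delta> > 0 \<and>
     (\<forall>f \<in> classA. Lf f \<le> ereal (exp \<delta>) * lf f \<longrightarrow> inj_on f (ball 0 1))}"

end

theory Submission
  imports Defs
begin

text \<open>Write p(z) = z f'(z) / f(z). In the coordinate w = log z the function g(w) = log f(exp w) on the
  half-plane Re w < 0 has derivative p(exp w), and f is univalent if and only if g is. If log |p| has
  oscillation at most \<delta>, the Schwarz-Pick lemma for maps into a strip bounds the derivative of log g'
  by (\<delta> / \<pi>) / |Re w|. For a \<noteq> b let c be the midpoint of a and b shifted by |a - b| / 2 away from the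
  imaginary axis. On the segments from c to a and to b the function g is so close to its affine
  approximation at c that g a \<noteq> g b as soon as (\<delta> / \<pi>) (2 + sqrt 2) < 1; the value \<delta> = 0.285 \<pi> is admissible.

  For the upper bound take p = C exp (i k Log N) with N a fractional linear map of the disc onto the
  right half-plane. Then log |p| has oscillation k \<pi>, and on the circle |p| takes two constant values with
  ratio exp (k \<pi>), separated by two conjugate points at which p spirals. The argument of f
  grows slowly along the arc where |p| is small; just behind the spiral point p is large with
  negative real part, and for k = 0.71 < 5/7 this makes the argument of f negative. Since
  f is symmetric with respect to the real axis, the intermediate value theorem yields a non-real z with
  f z real, hence f z = f (cnj z).\<close>

section \<open>A univalence criterion in the half-plane\<close>

text \<open>For 0 \<le> t \<le> 1 the derivative of exp(t z) is dominated by that of exp(t |z|),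
  hence so are the increments over [0,1].\<close>

lemma norm_exp_minus_one_le: "cmod (exp z - 1) \<le> exp (cmod z) - 1"
proof (cases "z = 0")
  case False
  have "norm (exp (1 *\<^sub>R z) - exp (0 *\<^sub>R z)) \<le> exp (1 * cmod z) - exp (0 * cmod z)"
  proof (rule differentiable_bound_general)
    show "((\<lambda>t. exp (t *\<^sub>R z)) has_vector_derivative exp (t *\<^sub>R z) * z) (at t)" for t
      by (rule exp_scaleR_has_vector_derivative_right)
    show "((\<lambda>t. exp (t * cmod z)) has_vector_derivative exp (t * cmod z) * cmod z) (at t)" for t
      unfolding has_real_derivative_iff_has_vector_derivative[symmetric]
      by (auto intro!: derivative_eq_intros)
    show "norm (exp (t *\<^sub>R z) * z) \<le> exp (t * cmod z) * cmod z" if "0 < t" "t < 1" for t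
      using norm_exp[of "t *\<^sub>R z"] that by (auto simp: norm_mult intro!: mult_right_mono)
  qed (auto intro!: continuous_intros)
  then show ?thesis by simp
qed simp

text \<open>Along the segment the distance to the imaginary axis shrinks at most linearly, so
  \<open>q\<close> moves by at most -A ln(1 - t), and the derivative of \<open>g\<close> deviates
  from \<open>exp (q c)\<close> by a relative error of at most (1 - t)^(-A) - 1. This is integrable
  since A < 1, with integral 1/(1 - A) - 1 = A/(1 - A).\<close>

lemma segment_deviation_bound:
  fixes g q q' :: "complex \<Rightarrow> complex" and k :: real
  assumes g: "\<And>w. Re w < 0 \<Longrightarrow> (g has_field_derivative exp (q w)) (at w)"
    and q: "\<And>w. Re w < 0 \<Longrightarrow> (q has_field_derivative q' w) (at w)"
    and bd: "\<And>w. Re w < 0 \<Longrightarrow> cmod (q' w) \<le> k / (- Re w)"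
    and c: "Re c < 0" and a: "Re a < 0"
    and A: "A = k * cmod (a - c) / (- Re c)" "A < 1"
  shows "cmod (g a - g c - exp (q c) * (a - c)) \<le> cmod (exp (q c)) * cmod (a - c) * (A / (1 - A))"
proof -
  define w where "w t = c + of_real t * (a - c)" for t :: real
  have Rew: "- Re (w t) \<ge> (1 - t) * (- Re c)" "Re (w t) < 0" if "0 \<le> t" "t \<le> 1" for t
  proof -
    have eq: "- Re (w t) = (1 - t) * (- Re c) + t * (- Re a)" by (simp add: w_def algebra_simps)
    have nn: "t * (- Re a) \<ge> 0" using that a by (intro mult_nonneg_nonneg) auto
    show "- Re (w t) \<ge> (1 - t) * (- Re c)" using eq nn by linarith
    \<comment> \<open>At \<open>t = 1\<close> the linear lower bound degenerates to 0, and
      negativity comes from \<open>Re a < 0\<close> instead.\<close>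
    show "Re (w t) < 0"
    proof (cases "t = 1")
      case True then show ?thesis using a by (simp add: w_def)
    next
      case False
      then have "(1 - t) * (- Re c) > 0" using that c by (intro mult_pos_pos) auto
      then show ?thesis using eq nn by linarith
    qed
  qed
  have dw: "(w has_vector_derivative (a - c)) (at t)" for t
    unfolding w_def has_vector_derivative_def by (auto intro!: derivative_eq_intros simp: scaleR_conv_of_real)
  have k0: "k \<ge> 0"
  proof -
    have "0 \<le> k / (- Re c)" using bd[OF c] norm_ge_zero order_trans by blast
    then show ?thesis using c by (subst (asm) zero_le_divide_iff) auto
  qed
  have A0: "A \<ge> 0" unfolding A using k0 c by (intro divide_nonneg_nonneg mult_nonneg_nonneg) auto
  have dq: "((\<lambda>t. q (w t)) has_vector_derivative (a - c) * q' (w t)) (at t)" if "0 \<le> t" "t \<le> 1" for t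
    using field_vector_diff_chain_at[OF dw q[OF Rew(2)[OF that]]] by (simp add: o_def)
  have qb: "cmod (q (w s) - q c) \<le> - A * ln (1 - s)" if s: "0 < s" "s < 1" for s
  proof -
    have "norm (q (w s) - q (w 0)) \<le> - A * ln (1 - s) - (- A * ln (1 - 0))"
    proof (rule differentiable_bound_general[OF s(1)])
      show "continuous_on {0..s} (\<lambda>t. q (w t))"
        using s by (intro continuous_at_imp_continuous_on ballI has_vector_derivative_continuous[OF dq]) auto
      show "continuous_on {0..s} (\<lambda>t. - A * ln (1 - t))"
        using s by (intro continuous_intros) auto
      show "((\<lambda>t. q (w t)) has_vector_derivative (a - c) * q' (w t)) (at t)" if "0 < t" "t < s" for t
        using dq that s by auto
      show "((\<lambda>t. - A * ln (1 - t)) has_vector_derivative A / (1 - t)) (at t)" if "0 < t" "t < s" for t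
        unfolding has_real_derivative_iff_has_vector_derivative[symmetric]
        using that s by (auto intro!: derivative_eq_intros simp: divide_simps)
      fix t assume t: "0 < t" "t < s"
      have pos: "(1 - t) * (- Re c) > 0" using t s c by (intro mult_pos_pos) auto
      have "cmod (q' (w t)) \<le> k / (- Re (w t))" using bd Rew t s by auto
      also have "\<dots> \<le> k / ((1 - t) * (- Re c))"
        using Rew[of t] t s c pos k0 by (intro divide_left_mono mult_pos_pos) (linarith | simp)+
      finally have "cmod (a - c) * cmod (q' (w t)) \<le> cmod (a - c) * (k / ((1 - t) * (- Re c)))"
        by (intro mult_left_mono) auto
      also have "\<dots> = A / (1 - t)" using c t s by (simp add: A field_simps)
      finally show "norm ((a - c) * q' (w t)) \<le> A / (1 - t)" by (simp add: norm_mult)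
    qed
    then show ?thesis by (simp add: w_def)
  qed
  define K where "K = cmod (exp (q c)) * cmod (a - c)"
  \<comment> \<open>\<open>u\<close> is the error of the affine approximation at \<open>c\<close>,
    and \<open>\<phi>\<close> is a primitive of the majorant of its speed. Since
    \<open>1 - A\<close> is positive, \<open>\<phi>\<close> remains continuous at t = 1, where the
    power is 0.\<close>
  define u where "u t = g (w t) - exp (q c) * (w t - c)" for t
  define \<phi> where "\<phi> t = K * (- ((1 - t) powr (1 - A)) / (1 - A) - t)" for t
  have du: "(u has_vector_derivative (a - c) * (exp (q (w t)) - exp (q c))) (at t)" if "0 \<le> t" "t \<le> 1" for t
  proof -
    have "((\<lambda>t. g (w t)) has_vector_derivative (a - c) * exp (q (w t))) (at t)"
      using field_vector_diff_chain_at[OF dw g[OF Rew(2)[OF that]]] by (simp add: o_def)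
    then show ?thesis unfolding u_def
      by (auto intro!: derivative_eq_intros dw simp: algebra_simps)
  qed
  have "norm (u 1 - u 0) \<le> \<phi> 1 - \<phi> 0"
  proof (rule differentiable_bound_general)
    show "continuous_on {0..1} u"
      by (intro continuous_at_imp_continuous_on ballI has_vector_derivative_continuous[OF du]) auto
    show "continuous_on {0..1} \<phi>"
      unfolding \<phi>_def using A(2) by (intro continuous_intros continuous_on_powr') auto
    show "(u has_vector_derivative (a - c) * (exp (q (w t)) - exp (q c))) (at t)" if "0 < t" "t < 1" for t
      using du that by auto
    show "(\<phi> has_vector_derivative K * ((1 - t) powr (- A) - 1)) (at t)" if "0 < t" "t < 1" for t
    proof -
      have d: "((\<lambda>t. (1 - t) powr (1 - A)) has_real_derivative - ((1 - A) * (1 - t) powr (- A))) (at t)"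
        using that by (auto intro!: derivative_eq_intros)
      show ?thesis
        using DERIV_cmult[OF DERIV_diff[OF DERIV_cdivide[OF DERIV_minus[OF d]] DERIV_ident], of K "1 - A"] A(2)
        unfolding has_real_derivative_iff_has_vector_derivative[symmetric] \<phi>_def by simp
    qed
    fix t :: real assume t: "0 < t" "t < 1"
    have "exp (q (w t)) - exp (q c) = exp (q c) * (exp (q (w t) - q c) - 1)"
      by (simp add: algebra_simps exp_diff)
    then have "norm ((a - c) * (exp (q (w t)) - exp (q c))) = K * cmod (exp (q (w t) - q c) - 1)"
      by (simp add: K_def norm_mult)
    also have "\<dots> \<le> K * (exp (cmod (q (w t) - q c)) - 1)"
      by (intro mult_left_mono norm_exp_minus_one_le) (auto simp: K_def)
    also have "\<dots> \<le> K * (exp (- A * ln (1 - t)) - 1)"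
      using qb[OF t] by (intro mult_left_mono) (auto simp: K_def)
    also have "\<dots> = K * ((1 - t) powr (- A) - 1)" using t by (simp add: powr_def)
    finally show "norm ((a - c) * (exp (q (w t)) - exp (q c))) \<le> K * ((1 - t) powr (- A) - 1)" .
  qed simp
  also have "\<phi> 1 - \<phi> 0 = K * (A / (1 - A))" using A(2) by (simp add: \<phi>_def field_simps)
  finally show ?thesis by (simp add: u_def w_def K_def algebra_simps)
qed

text \<open>If g a = g b, then exp(q c) (b - a) is a difference of two deviations from the affine
  map at \<open>c\<close>. Together they amount to at most |exp(q c)| 4 k r / (1 - k sqrt 2),
  against |exp(q c)| 2 r on the left, which forces 1 \<le> k (2 + sqrt 2).\<close>

lemma half_plane_univalence_criterion:
  fixes g q q' :: "complex \<Rightarrow> complex" and k :: real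
  assumes g: "\<And>w. Re w < 0 \<Longrightarrow> (g has_field_derivative exp (q w)) (at w)"
    and q: "\<And>w. Re w < 0 \<Longrightarrow> (q has_field_derivative q' w) (at w)"
    and bd: "\<And>w. Re w < 0 \<Longrightarrow> cmod (q' w) \<le> k / (- Re w)"
    and k: "0 \<le> k" "k * (2 + sqrt 2) < 1"
  shows "inj_on g {w. Re w < 0}"
proof (rule inj_onI, rule ccontr)
  fix a b assume "a \<in> {w. Re w < 0}" "b \<in> {w. Re w < 0}" and eq: "g a = g b" and ne: "a \<noteq> b"
  then have a: "Re a < 0" and b: "Re b < 0" by auto
  define r where "r = cmod (a - b) / 2"
  \<comment> \<open>The shift guarantees \<open>d \<ge> r\<close> even when \<open>a\<close> and
    \<open>b\<close> are close to the axis, so that the segments from \<open>c\<close> are at most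
    sqrt 2 times \<open>d\<close> long.\<close>
  define c where "c = (a + b) / 2 - of_real r"
  define d where "d = - Re c"
  have r: "r > 0" using ne by (simp add: r_def)
  have d: "d = r - (Re a + Re b) / 2" by (simp add: d_def c_def)
  have dr: "d \<ge> r" using d a b by simp
  have c: "Re c < 0" using dr r by (simp add: d_def)
  have key: "cmod (x - c) * (k * cmod (x - c) / d / (1 - k * cmod (x - c) / d)) \<le> 2 * k * r / (1 - k * sqrt 2)"
      "k * cmod (x - c) / d < 1"
    if x: "x = a \<and> y = b \<or> x = b \<and> y = a" for x y
  proof -
    have xc: "x - c = (x - y) / 2 + of_real r" using x by (auto simp: c_def field_simps)
    have r2: "((Re x - Re y) / 2)\<^sup>2 + ((Im x - Im y) / 2)\<^sup>2 = r\<^sup>2"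
    proof -
      have "r = cmod ((x - y) / 2)" using x by (auto simp: r_def norm_divide norm_minus_commute)
      then have "r\<^sup>2 = (cmod ((x - y) / 2))\<^sup>2" by (rule arg_cong)
      then show ?thesis unfolding cmod_power2 by simp
    qed
    have "(cmod (x - c))\<^sup>2 = 2 * r\<^sup>2 + r * (Re x - Re y)"
      unfolding xc cmod_power2 using r2 by (simp add: power2_eq_square algebra_simps)
    also have "\<dots> \<le> 2 * r * d"
    proof -
      have "r * Re x < 0" using x a b r by (auto intro!: mult_pos_neg)
      moreover have "2 * r * d = 2 * r\<^sup>2 - r * (Re x + Re y)" using x d by (auto simp: power2_eq_square algebra_simps)
      ultimately show ?thesis by (simp add: algebra_simps)
    qed
    \<comment> \<open>This bound is used twice. With r replaced by d it gives the length bound and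
      hence A \<le> k sqrt 2; kept as it is, it bounds the numerator k |x - c|^2 / d by 2 k
      r.\<close>
    finally have sq: "(cmod (x - c))\<^sup>2 \<le> 2 * r * d" .
    also have "\<dots> \<le> 2 * d * d" using dr r by (intro mult_right_mono) auto
    also have "\<dots> = (sqrt 2 * d)\<^sup>2" by (simp add: power_mult_distrib power2_eq_square)
    finally have le: "cmod (x - c) \<le> sqrt 2 * d" by (rule power2_le_imp_le) (use dr r in simp)
    then have "k * cmod (x - c) \<le> k * (sqrt 2 * d)" using k by (intro mult_left_mono) auto
    then have A: "k * cmod (x - c) / d \<le> k * sqrt 2" using dr r by (simp add: field_simps)
    have k2: "k * sqrt 2 < 1" using k by (simp add: algebra_simps)
    show "k * cmod (x - c) / d < 1" using A k2 by linarith
    have "cmod (x - c) * (k * cmod (x - c) / d / (1 - k * cmod (x - c) / d))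
        = (k * (cmod (x - c))\<^sup>2 / d) / (1 - k * cmod (x - c) / d)" by (simp add: power2_eq_square)
    also have "\<dots> \<le> (2 * k * r) / (1 - k * sqrt 2)"
    proof (rule frac_le)
      have "k * (cmod (x - c))\<^sup>2 \<le> k * (2 * r * d)" using sq k by (intro mult_left_mono) auto
      then show "k * (cmod (x - c))\<^sup>2 / d \<le> 2 * k * r" using dr r by (simp add: field_simps)
    qed (use A k2 r k in auto)
    finally show "cmod (x - c) * (k * cmod (x - c) / d / (1 - k * cmod (x - c) / d)) \<le> 2 * k * r / (1 - k * sqrt 2)" .
  qed
  define E where "E = exp (q c)"
  have dev: "cmod (g x - g c - E * (x - c)) \<le> cmod E * (2 * k * r / (1 - k * sqrt 2))"
    if x: "x = a \<and> y = b \<or> x = b \<and> y = a" for x y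
  proof -
    have "cmod (g x - g c - E * (x - c)) \<le> cmod E * cmod (x - c) * (k * cmod (x - c) / d / (1 - k * cmod (x - c) / d))"
      unfolding E_def d_def
      by (rule segment_deviation_bound[OF g q bd c _ refl]) (use key(2)[OF x] x a b in \<open>auto simp: d_def\<close>)
    also have "\<dots> \<le> cmod E * (2 * k * r / (1 - k * sqrt 2))"
      using key(1)[OF x] unfolding mult.assoc by (intro mult_left_mono) auto
    finally show ?thesis .
  qed
  have "E * (b - a) = (g a - g c - E * (a - c)) - (g b - g c - E * (b - c))"
    using eq by (simp add: algebra_simps)
  then have "cmod E * cmod (b - a) \<le> cmod (g a - g c - E * (a - c)) + cmod (g b - g c - E * (b - c))"
    by (metis norm_mult norm_triangle_ineq4)
  also have "\<dots> \<le> cmod E * (2 * k * r / (1 - k * sqrt 2)) + cmod E * (2 * k * r / (1 - k * sqrt 2))"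
    by (intro add_mono dev[of a b] dev[of b a]) auto
  also have "\<dots> = cmod E * (2 * (2 * k * r / (1 - k * sqrt 2)))" by (simp only: mult_2 distrib_left)
  finally have "cmod (b - a) \<le> 2 * (2 * k * r / (1 - k * sqrt 2))"
    by (rule mult_left_le_imp_le) (simp add: E_def)
  moreover have "cmod (b - a) = 2 * r" by (simp add: r_def norm_minus_commute)
  ultimately have "r \<le> 2 * k * r / (1 - k * sqrt 2)" by simp
  moreover have "1 - k * sqrt 2 > 0" using k by (simp add: algebra_simps)
  ultimately have "r * (1 - k * sqrt 2) \<le> r * (2 * k)" by (simp add: field_simps)
  then have "1 - k * sqrt 2 \<le> 2 * k" using r by simp
  then show False using k by (simp add: algebra_simps)
qed

section \<open>Schwarz-Pick bound for functions with values in a strip\<close>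

text \<open>The Schwarz lemma is applied to \<open>\<phi>\<close>, composed of a map
  \<open>W\<close> of the disc to the left half-plane with \<open>W 0 = w\<close>, the function
  \<open>q\<close>, an exponential taking the strip to the right half-plane, and a Moebius map to
  the disc sending \<open>F w\<close> to 0. The derivative of \<open>W\<close> at 0 is 2 Re w, which
  produces the factor 1 / (- Re w).\<close>

lemma strip_half_plane_Schwarz:
  fixes q :: "complex \<Rightarrow> complex"
  assumes q: "q holomorphic_on {w. Re w < 0}"
    and strip: "\<And>w. Re w < 0 \<Longrightarrow> \<bar>Re (q w) - m\<bar> < \<delta> / 2"
    and w: "Re w < 0"
  shows "cmod (deriv q w) \<le> (\<delta> / pi) / (- Re w)"
proof -
  have \<delta>: "\<delta> > 0" using strip[OF w] by linarith
  define W where "W \<zeta> = of_real (Re w) * ((1 + \<zeta>) / (1 - \<zeta>)) + \<i> * of_real (Im w)" for \<zeta>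
  have ne1: "1 - \<zeta> \<noteq> 0" if "cmod \<zeta> < 1" for \<zeta> using that by auto
  have ReW: "Re (W \<zeta>) < 0" if "cmod \<zeta> < 1" for \<zeta>
  proof -
    have "(cmod \<zeta>)\<^sup>2 < 1" using that by (simp add: power_less_one_iff abs_square_less_1)
    then have "Re ((1 + \<zeta>) * cnj (1 - \<zeta>)) > 0"
      unfolding cmod_power2 by (simp add: algebra_simps power2_eq_square)
    then have "Re ((1 + \<zeta>) / (1 - \<zeta>)) > 0"
      using ne1[OF that] by (simp add: complex_div_cnj[of "1 + \<zeta>"] Re_divide_of_real)
    then have "Re w * Re ((1 + \<zeta>) / (1 - \<zeta>)) < 0" using w by (intro mult_neg_pos)
    then show ?thesis unfolding W_def by (simp del: times_divide_eq_right)
  qed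
  have W0: "W 0 = w" by (simp add: W_def complex_eq_iff)
  have dW: "(W has_field_derivative of_real (Re w) * 2) (at 0)"
    unfolding W_def by (auto intro!: derivative_eq_intros)
  define F where "F w = exp (\<i> * of_real (pi / \<delta>) * (q w - of_real m))" for w
  have ReF: "Re (F w) > 0" if "Re w < 0" for w
  proof -
    have "pi / \<delta> * \<bar>Re (q w) - m\<bar> < pi / \<delta> * (\<delta> / 2)"
      using strip[OF that] \<delta> by (intro mult_strict_left_mono) auto
    then have "\<bar>pi / \<delta> * (Re (q w) - m)\<bar> < pi / 2"
      using \<delta> by (simp add: abs_mult)
    then have "cos (pi / \<delta> * (Re (q w) - m)) > 0"
      unfolding abs_less_iff by (intro cos_gt_zero_pi) linarith+
    then show ?thesis by (simp add: F_def Re_exp)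
  qed
  define \<phi> where "\<phi> \<zeta> = (F (W \<zeta>) - F w) / (F (W \<zeta>) + cnj (F w))" for \<zeta>
  have den: "F (W \<zeta>) + cnj (F w) \<noteq> 0" if "cmod \<zeta> < 1" for \<zeta>
    using ReF[OF ReW[OF that]] ReF[OF w] by (auto simp: complex_eq_iff)
  have holF: "F holomorphic_on {w. Re w < 0}" unfolding F_def using q by (intro holomorphic_intros)
  have holW: "W holomorphic_on ball 0 1" unfolding W_def using ne1 by (intro holomorphic_intros) auto
  have holFW: "(\<lambda>\<zeta>. F (W \<zeta>)) holomorphic_on ball 0 1"
    by (rule holomorphic_on_compose_gen[OF holW holF, unfolded o_def]) (use ReW in auto)
  have "\<phi> holomorphic_on ball 0 1" unfolding \<phi>_def using den
    by (intro holomorphic_intros holFW) auto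
  moreover have "\<phi> 0 = 0" by (simp add: \<phi>_def W0)
  moreover have "cmod (\<phi> \<zeta>) < 1" if "cmod \<zeta> < 1" for \<zeta>
  proof -
    have p: "Re (F (W \<zeta>)) * Re (F w) > 0" using ReF[OF ReW[OF that]] ReF[OF w] by simp
    have "(cmod (F (W \<zeta>) - F w))\<^sup>2 < (cmod (F (W \<zeta>) + cnj (F w)))\<^sup>2"
      unfolding cmod_power2 using p by (simp add: power2_eq_square algebra_simps)
    then have "cmod (F (W \<zeta>) - F w) < cmod (F (W \<zeta>) + cnj (F w))"
      using norm_ge_zero power2_less_imp_less by blast
    then show ?thesis using den[OF that] by (simp add: \<phi>_def norm_divide)
  qed
  ultimately have le: "cmod (deriv \<phi> 0) \<le> 1" by (intro Schwarz_Lemma(2)[where \<xi>=0]) auto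
  have dq: "(q has_field_derivative deriv q w) (at w)"
    using q w by (intro holomorphic_derivI[where S="{w. Re w < 0}"]) (auto simp: open_halfspace_Re_lt)
  have dF: "(F has_field_derivative \<i> * of_real (pi / \<delta>) * deriv q w * F w) (at w)"
    using DERIV_chain2[OF DERIV_exp DERIV_cmult[OF DERIV_diff[OF dq DERIV_const]], of "\<i> * of_real (pi / \<delta>)" "of_real m"]
    unfolding F_def by (simp add: mult_ac)
  have dFW: "((\<lambda>\<zeta>. F (W \<zeta>)) has_field_derivative \<i> * of_real (pi / \<delta>) * deriv q w * F w * (of_real (Re w) * 2)) (at 0)"
    by (rule DERIV_chain2[of F _ W, OF _ dW]) (use dF W0 in simp)
  have "(\<phi> has_field_derivative (\<i> * of_real (pi / \<delta>) * deriv q w * F w * (of_real (Re w) * 2)) / (F w + cnj (F w))) (at 0)"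
    unfolding \<phi>_def using den[of 0]
    by (auto intro!: derivative_eq_intros dFW simp: W0 divide_simps)
  then have "deriv \<phi> 0 = (\<i> * of_real (pi / \<delta>) * deriv q w * F w * (of_real (Re w) * 2)) / of_real (2 * Re (F w))"
    by (simp add: DERIV_imp_deriv complex_add_cnj)
  then have "cmod (deriv \<phi> 0) = (pi / \<delta>) * cmod (deriv q w) * cmod (F w) * (- Re w) / Re (F w)"
    using w \<delta> ReF[OF w] by (simp add: norm_mult norm_divide)
  with le have "(pi / \<delta>) * cmod (deriv q w) * cmod (F w) * (- Re w) / Re (F w) \<le> 1" by simp
  then have "(pi / \<delta>) * cmod (deriv q w) * cmod (F w) * (- Re w) \<le> Re (F w)"
    using ReF[OF w] by (subst (asm) divide_le_eq_1_pos)
  then have "(pi / \<delta>) * cmod (deriv q w) * (- Re w) * cmod (F w) \<le> Re (F w)" by (simp only: mult_ac)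
  \<comment> \<open>Estimating \<open>Re (F w)\<close> by \<open>cmod (F w)\<close> lets
    \<open>F w\<close> cancel, so the position of \<open>q w\<close> inside the strip does not enter
    the bound.\<close>
  also have "\<dots> \<le> 1 * cmod (F w)" using complex_Re_le_cmod by simp
  finally have "(pi / \<delta>) * cmod (deriv q w) * (- Re w) \<le> 1"
    by (rule mult_right_le_imp_le) (simp add: F_def)
  then show ?thesis using w \<delta> by (simp only: pos_le_divide_eq neg_0_less_iff_less) (simp add: field_simps)
qed


section \<open>Logarithmic coordinates and the lower bound\<close>

text \<open>At a zero \<xi> \<noteq> 0 of order n the quotient z f'(z)/f(z) has a simple pole with
  residue n \<xi>, which contradicts a bound at the nearby points where f does not vanish.\<close>

lemma zq_bounded_imp_nonzero:
  assumes f: "f \<in> classA" and bd: "\<And>z. z \<in> dom_q f \<Longrightarrow> cmod (zq f z) \<le> M"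
    and \<xi>: "\<xi> \<in> ball 0 1" "\<xi> \<noteq> 0"
  shows "f \<xi> \<noteq> 0"
proof
  assume 0: "f \<xi> = 0"
  have hol: "f holomorphic_on ball 0 1" and f0: "f 0 = 0" and d0: "deriv f 0 = 1"
    using f by (auto simp: classA_def)
  \<comment> \<open>Since f'(0) = 1, f is not constant, and the zero has finite order.\<close>
  have "\<not> f constant_on ball 0 1"
  proof
    assume "f constant_on ball 0 1"
    then obtain c where c: "\<And>z. z \<in> ball 0 1 \<Longrightarrow> f z = c" by (auto simp: constant_on_def)
    then have "deriv f 0 = deriv (\<lambda>_. c) 0"
      by (intro deriv_cong_ev refl) (auto intro!: eventually_nhds_in_open[of "ball 0 1", THEN eventually_mono])
    then show False using d0 by simp
  qed
  then obtain g r n where n: "0 < n" and r: "0 < r" and sub: "ball \<xi> r \<subseteq> ball 0 1"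
    and g: "g holomorphic_on ball \<xi> r"
    and fg: "\<And>w. w \<in> ball \<xi> r \<Longrightarrow> f w = (w - \<xi>)^n * g w"
    and gn: "\<And>w. w \<in> ball \<xi> r \<Longrightarrow> g w \<noteq> 0"
    using holomorphic_factor_zero_nonconstant[OF hol open_ball connected_ball \<xi>(1) 0] by metis
  obtain j where j: "n = Suc j" using n by (cases n) auto
  \<comment> \<open>The bound on \<open>zq f\<close> with denominators cleared and the factor |w -
    \<xi>|^j, j = n - 1, cancelled. Both sides are now continuous at \<xi>.\<close>
  have ineq: "cmod (w * (of_nat n * g w + (w - \<xi>) * deriv g w)) \<le> M * cmod (w - \<xi>) * cmod (g w)"
    if w: "w \<in> ball \<xi> r" "w \<noteq> \<xi>" "w \<noteq> 0" for w
  proof -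
    have fw: "f w \<noteq> 0" using fg[OF w(1)] gn[OF w(1)] w by simp
    have "((\<lambda>w. (w - \<xi>)^n * g w) has_field_derivative
        (w - \<xi>)^j * (of_nat n * g w + (w - \<xi>) * deriv g w)) (at w)"
      using DERIV_mult[OF DERIV_power[OF DERIV_diff[OF DERIV_ident DERIV_const]]
          holomorphic_derivI[OF g open_ball w(1)], of _ n]
      by (simp add: j algebra_simps)
    then have "(f has_field_derivative (w - \<xi>)^j * (of_nat n * g w + (w - \<xi>) * deriv g w)) (at w)"
      by (rule has_field_derivative_transform_within_open[OF _ open_ball w(1)]) (simp add: fg)
    then have df: "deriv f w = (w - \<xi>)^j * (of_nat n * g w + (w - \<xi>) * deriv g w)"
      by (rule DERIV_imp_deriv)
    have "cmod (w * deriv f w / f w) \<le> M"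
      using bd[of w] fw w sub by (auto simp: dom_q_def zq_def)
    then have "cmod (w * deriv f w) \<le> M * cmod (f w)"
      using fw by (simp add: norm_divide norm_mult field_simps)
    then have "cmod (w - \<xi>) ^ j * cmod (w * (of_nat n * g w + (w - \<xi>) * deriv g w))
        \<le> cmod (w - \<xi>) ^ j * (M * cmod (w - \<xi>) * cmod (g w))"
      unfolding df fg[OF w(1)] by (simp add: norm_mult norm_power j mult_ac)
    then show ?thesis using w by simp
  qed
  have \<xi>r: "\<xi> \<in> ball \<xi> r" using r by simp
  have tg: "(g \<longlongrightarrow> g \<xi>) (at \<xi>)" and tdg: "(deriv g \<longlongrightarrow> deriv g \<xi>) (at \<xi>)"
    using holomorphic_on_imp_continuous_on[OF g]
      holomorphic_on_imp_continuous_on[OF holomorphic_deriv[OF g open_ball]]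
    by (auto simp: continuous_on_eq_continuous_at isCont_def r)
  \<comment> \<open>In the limit the right side is 0, while the left side is |n \<xi> g(\<xi>)|,
    which is positive.\<close>
  have "cmod (\<xi> * (of_nat n * g \<xi> + (\<xi> - \<xi>) * deriv g \<xi>)) \<le> M * cmod (\<xi> - \<xi>) * cmod (g \<xi>)"
  proof (rule tendsto_le[of "at \<xi>"])
    show "((\<lambda>w. M * cmod (w - \<xi>) * cmod (g w)) \<longlongrightarrow> M * cmod (\<xi> - \<xi>) * cmod (g \<xi>)) (at \<xi>)"
      by (intro tendsto_intros tg)
    show "((\<lambda>w. cmod (w * (of_nat n * g w + (w - \<xi>) * deriv g w))) \<longlongrightarrow>
        cmod (\<xi> * (of_nat n * g \<xi> + (\<xi> - \<xi>) * deriv g \<xi>))) (at \<xi>)"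
      by (intro tendsto_intros tg tdg)
    have "\<forall>\<^sub>F w in at \<xi>. w \<in> ball \<xi> r - {0} - {\<xi>}"
      using \<xi>r \<xi>(2) by (intro eventually_at_in_open) (auto simp: open_delete)
    then show "\<forall>\<^sub>F w in at \<xi>. cmod (w * (of_nat n * g w + (w - \<xi>) * deriv g w)) \<le> M * cmod (w - \<xi>) * cmod (g w)"
      by eventually_elim (use ineq in auto)
  qed simp
  then show False using \<xi> n gn[OF \<xi>r] by simp
qed

text \<open>f(z)/z extends to a zero-free holomorphic function on the disc, with value 1 at 0, and
  therefore has a holomorphic logarithm \<open>P\<close>.\<close>

lemma classA_exp_representation:
  assumes f: "f \<in> classA" and nz: "\<And>z. z \<in> ball 0 1 \<Longrightarrow> z \<noteq> 0 \<Longrightarrow> f z \<noteq> 0"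
  obtains P where "P holomorphic_on ball 0 1" "\<And>z. z \<in> ball 0 1 \<Longrightarrow> f z = z * exp (P z)"
    "\<And>z. z \<in> ball 0 1 \<Longrightarrow> zq f z = 1 + z * deriv P z"
proof -
  have hol: "f holomorphic_on ball 0 1" and f0: "f 0 = 0" and d0: "deriv f 0 = 1"
    using f by (auto simp: classA_def)
  obtain h where h: "h holomorphic_on ball 0 1" and fh: "\<And>z. norm z < 1 \<Longrightarrow> f z = z * h z"
      and h0: "deriv f 0 = h 0"
    using Schwarz3[OF hol f0] by metis
  have "h z \<noteq> 0" if "z \<in> ball 0 1" for z
    using nz[OF that] fh[of z] h0 d0 that by (cases "z = 0") auto
  then obtain P where P: "P holomorphic_on ball 0 1" and hP: "\<And>z. z \<in> ball 0 1 \<Longrightarrow> h z = exp (P z)"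
    using contractible_imp_holomorphic_log[OF h convex_imp_contractible[OF convex_ball]] by blast
  show ?thesis
  proof
    show "P holomorphic_on ball 0 1" by fact
    show fP: "f z = z * exp (P z)" if "z \<in> ball 0 1" for z using fh hP that by auto
    fix z :: complex assume z: "z \<in> ball 0 1"
    have "((\<lambda>z. z * exp (P z)) has_field_derivative exp (P z) * (1 + z * deriv P z)) (at z)"
      using holomorphic_derivI[OF P open_ball z] by (auto intro!: derivative_eq_intros simp: algebra_simps)
    then have "(f has_field_derivative exp (P z) * (1 + z * deriv P z)) (at z)"
      by (rule has_field_derivative_transform_within_open[OF _ open_ball z]) (simp add: fP)
    then show "zq f z = 1 + z * deriv P z"
      using fP[OF z] by (simp add: zq_def DERIV_imp_deriv)
  qed
qed

text \<open>The ratio hypothesis confines log |zq f| to a closed interval of length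
  \<open>\<delta>\<close>; the slightly larger \<open>\<delta>'\<close> turns it into the open strip
  that the derivative bound requires.\<close>

lemma univalent_if_zq_ratio_small:
  assumes f: "f \<in> classA" and \<delta>: "0 < \<delta>" "\<delta> < \<delta>'" "\<delta>' / pi * (2 + sqrt 2) < 1"
    and ratio: "Lf f \<le> ereal (exp \<delta>) * lf f"
  shows "inj_on f (ball 0 1)"
proof -
  have 0: "0 \<in> dom_q f" "zq f 0 = 1" by (auto simp: dom_q_def zq_def)
  have "lf f \<le> 1" unfolding lf_def by (rule INF_lower2[OF 0(1)]) (simp add: 0)
  moreover have "lf f \<ge> 0" unfolding lf_def by (rule INF_greatest) simp
  ultimately obtain l where l: "lf f = ereal l" by (cases "lf f") auto
  have lower: "l \<le> cmod (zq f z)" if "z \<in> dom_q f" for z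
    using INF_lower[OF that, of "\<lambda>z. ereal (cmod (zq f z))"] l by (simp add: lf_def)
  have upper: "cmod (zq f z) \<le> exp \<delta> * l" if "z \<in> dom_q f" for z
    using order_trans[OF SUP_upper[OF that, of "\<lambda>z. ereal (cmod (zq f z))"] ratio[unfolded Lf_def]] l by simp
  \<comment> \<open>The value 1 of the quotient at 0 gives 1 \<le> exp \<delta> * l.\<close>
  have l0: "l > 0" using upper[OF 0(1)] 0(2)
    by (metis exp_gt_zero less_le_trans norm_one zero_less_mult_pos zero_less_one)
  have nz: "f z \<noteq> 0" if "z \<in> ball 0 1" "z \<noteq> 0" for z
    using zq_bounded_imp_nonzero[OF f upper that] .
  then have dom: "dom_q f = ball 0 1" by (auto simp: dom_q_def)
  obtain P where P: "P holomorphic_on ball 0 1" and fP: "\<And>z. z \<in> ball 0 1 \<Longrightarrow> f z = z * exp (P z)"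
    and zqP: "\<And>z. z \<in> ball 0 1 \<Longrightarrow> zq f z = 1 + z * deriv P z"
    using classA_exp_representation[OF f nz] by metis
  have holp: "(\<lambda>z. 1 + z * deriv P z) holomorphic_on ball 0 1"
    using P by (intro holomorphic_intros) auto
  have pnz: "1 + z * deriv P z \<noteq> 0" if "z \<in> ball 0 1" for z
    using lower[of z] l0 zqP[OF that] that dom by auto
  obtain Q where Q: "Q holomorphic_on ball 0 1"
    and PQ: "\<And>z. z \<in> ball 0 1 \<Longrightarrow> 1 + z * deriv P z = exp (Q z)"
    by (rule contractible_imp_holomorphic_log[OF holp convex_imp_contractible[OF convex_ball] pnz]) blast+
  have Re_strip: "\<bar>Re (Q z) - (ln l + \<delta> / 2)\<bar> < \<delta>' / 2" if z: "z \<in> ball 0 1" for z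
  proof -
    have "cmod (zq f z) = exp (Re (Q z))" using zqP PQ z by simp
    then have "l \<le> exp (Re (Q z))" "exp (Re (Q z)) \<le> exp \<delta> * l" using lower upper z dom by metis+
    moreover have "exp (ln l) = l" "exp (\<delta> + ln l) = exp \<delta> * l" using l0 by (auto simp: exp_add)
    ultimately have "ln l \<le> Re (Q z)" "Re (Q z) \<le> \<delta> + ln l" by (metis exp_le_cancel_iff)+
    then show ?thesis using \<delta> by (simp add: abs_le_iff abs_less_iff field_simps)
  qed
  \<comment> \<open>With w = log z, \<open>g\<close> is a logarithm of \<open>f (exp w)\<close>, and
    its derivative is \<open>zq f (exp w) = exp (q w)\<close>.\<close>
  define q where "q w = Q (exp w)" for w
  define g where "g w = w + P (exp w)" for w
  have exp_ball: "exp w \<in> ball 0 1" if "Re w < 0" for w :: complex using that by simp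
  have holq: "q holomorphic_on {w. Re w < 0}"
    unfolding q_def by (rule holomorphic_on_compose_gen[OF holomorphic_on_exp Q, unfolded o_def]) (use exp_ball in auto)
  have opn: "open {w. Re w < 0}" by (rule open_halfspace_Re_lt)
  have "inj_on g {w. Re w < 0}"
  proof (rule half_plane_univalence_criterion[where k="\<delta>' / pi" and q=q and q'="deriv q"])
    fix w :: complex assume w: "Re w < 0"
    have "(g has_field_derivative 1 + deriv P (exp w) * exp w) (at w)"
      unfolding g_def
      by (intro DERIV_add DERIV_ident DERIV_chain2[of P] holomorphic_derivI[OF P open_ball exp_ball[OF w]] DERIV_exp)
    then show "(g has_field_derivative exp (q w)) (at w)"
      using PQ[OF exp_ball[OF w]] by (simp add: q_def mult.commute)
    show "(q has_field_derivative deriv q w) (at w)" using holomorphic_derivI[OF holq opn] w by simp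
    show "cmod (deriv q w) \<le> \<delta>' / pi / (- Re w)"
      by (rule strip_half_plane_Schwarz[OF holq _ w, where m="ln l + \<delta> / 2"]) (use Re_strip[OF exp_ball] in \<open>auto simp: q_def\<close>)
  qed (use \<delta> in auto)
  show ?thesis
  proof (rule inj_onI)
    fix z1 z2 :: complex assume z: "z1 \<in> ball 0 1" "z2 \<in> ball 0 1" and eq: "f z1 = f z2"
    show "z1 = z2"
    proof (cases "z1 = 0 \<or> z2 = 0")
      case True
      then show ?thesis using fP z eq by auto
    next
      case False
      define w1 w2 where "w1 = Ln z1" and "w2 = Ln z2"
      have w: "exp w1 = z1" "exp w2 = z2" "Re w1 < 0" "Re w2 < 0"
        using False z by (auto simp: w1_def w2_def)
      have "exp (g w1) = exp (g w2)"
        using eq fP z w by (simp add: g_def exp_add)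
      then obtain n :: int where n: "g w1 = g w2 + of_int (2 * n) * pi * \<i>"
        using exp_eq by blast
      \<comment> \<open>\<open>P (exp w)\<close> has period 2 pi i, so shifting the argument of
        \<open>g\<close> shifts its value by the same multiple of 2 pi i. This absorbs the ambiguity
        of the logarithm.\<close>
      define w3 where "w3 = w2 + of_int (2 * n) * pi * \<i>"
      have e3: "exp w3 = exp w2" unfolding exp_eq w3_def by blast
      have "g w3 = g w1" using n e3 by (simp add: g_def w3_def)
      moreover have "Re w3 < 0" using w by (simp add: w3_def)
      ultimately have "w3 = w1" using \<open>inj_on g _\<close> w by (auto dest: inj_onD)
      then show ?thesis using e3 w by simp
    qed
  qed
qed

lemma delta1_lower: "ereal (7 * pi / 25) < delta1"
proof -
  \<comment> \<open>Strictness requires an admissible value above 0.28 pi. The value 0.285 pi, with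
    0.29 pi as the larger strip width, works because 0.29 * (2 + 1.42) < 1.\<close>
  have s2: "sqrt 2 < 1.42" by (rule real_less_lsqrt) (auto simp: power2_eq_square)
  have "ereal (7 * pi / 25) < ereal (285 * pi / 1000)" by simp
  also have "\<dots> \<le> delta1"
    unfolding delta1_def
  proof (rule Sup_upper, intro CollectI exI conjI ballI impI)
    fix f assume "f \<in> classA" "Lf f \<le> ereal (exp (285 * pi / 1000)) * lf f"
    then show "inj_on f (ball 0 1)"
      using s2 by (intro univalent_if_zq_ratio_small[where \<delta>="285 * pi / 1000" and \<delta>'="29 * pi / 100"]) auto
  qed auto
  finally show ?thesis .
qed

section \<open>A non-univalent function with small oscillation\<close>

text \<open>The logarithmic derivative is integrated: (p - 1)/z is holomorphic because p 0 = 1, and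
  \<open>P\<close> is its primitive vanishing at 0.\<close>

lemma classA_with_prescribed_zq:
  assumes p: "p holomorphic_on ball 0 1" and p0: "p 0 = 1"
  obtains P where "P holomorphic_on ball 0 1" "P 0 = 0" "\<And>z. z \<in> ball 0 1 \<Longrightarrow> z * deriv P z = p z - 1"
    "(\<lambda>z. z * exp (P z)) \<in> classA" "\<And>z. z \<in> ball 0 1 \<Longrightarrow> zq (\<lambda>z. z * exp (P z)) z = p z"
    "dom_q (\<lambda>z. z * exp (P z)) = ball 0 1"
proof -
  have "(\<lambda>z. p z - 1) holomorphic_on ball 0 1" "p 0 - 1 = 0" using p p0 by (auto intro!: holomorphic_intros)
  then obtain h where h: "h holomorphic_on ball 0 1" and ph: "\<And>z. norm z < 1 \<Longrightarrow> p z - 1 = z * h z"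
    using Schwarz3[of "\<lambda>z. p z - 1" 1] by metis
  obtain P1 where P1: "\<And>z. z \<in> ball 0 1 \<Longrightarrow> (P1 has_field_derivative h z) (at z within ball 0 1)"
    by (rule holomorphic_convex_primitive'[OF convex_ball open_ball h]) blast
  define P where "P z = P1 z - P1 0" for z
  have dP: "(P has_field_derivative h z) (at z)" if "z \<in> ball 0 1" for z
    using DERIV_diff[OF P1[OF that] DERIV_const, of "P1 0"] at_within_open[OF that open_ball] by (simp add: P_def[abs_def])
  have dP': "deriv P z = h z" if "z \<in> ball 0 1" for z using dP[OF that] by (rule DERIV_imp_deriv)
  have P: "P holomorphic_on ball 0 1" using dP unfolding holomorphic_on_open[OF open_ball] by blast
  have df: "((\<lambda>z. z * exp (P z)) has_field_derivative exp (P z) * p z) (at z)" if "z \<in> ball 0 1" for z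
    using DERIV_mult[OF DERIV_ident DERIV_chain2[OF DERIV_exp dP[OF that]]] ph[of z] that
    by (simp add: algebra_simps)
  show ?thesis
  proof
    show "P holomorphic_on ball 0 1" by (fact P)
    show "P 0 = 0" by (simp add: P_def)
    show "z * deriv P z = p z - 1" if "z \<in> ball 0 1" for z using dP'[OF that] ph that by simp
    show "(\<lambda>z. z * exp (P z)) \<in> classA"
      using P DERIV_imp_deriv[OF df[of 0]] p0 \<open>P 0 = 0\<close> by (auto simp: classA_def intro!: holomorphic_intros)
    show "zq (\<lambda>z. z * exp (P z)) z = p z" if "z \<in> ball 0 1" for z
      using DERIV_imp_deriv[OF df[OF that]] p0 by (auto simp: zq_def)
    show "dom_q (\<lambda>z. z * exp (P z)) = ball 0 1" by (auto simp: dom_q_def)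
  qed
qed

text \<open>Off 0 the derivative of \<open>P\<close> is determined by \<open>p\<close>, so
  \<open>P\<close> and its conjugate reflection have the same derivative there, and they agree at
  0.\<close>

lemma primitive_real_symmetric:
  assumes P: "P holomorphic_on ball 0 1" and P0: "P 0 = 0"
    and dP: "\<And>z. z \<in> ball 0 1 \<Longrightarrow> z * deriv P z = p z - 1"
    and sym: "\<And>z. z \<in> ball 0 1 \<Longrightarrow> p (cnj z) = cnj (p z)"
    and z: "z \<in> ball 0 1"
  shows "P (cnj z) = cnj (P z)"
proof -
  define D where "D z = (cnj \<circ> P \<circ> cnj) z - P z" for z
  have cont: "continuous_on (ball 0 1) P" using P by (rule holomorphic_on_imp_continuous_on)
  have "continuous_on (ball 0 1) (\<lambda>z. P (cnj z))"
    by (rule continuous_on_compose2[OF cont]) (auto intro!: continuous_intros)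
  then have contD: "continuous_on (ball 0 1) D"
    unfolding D_def o_def by (intro continuous_intros cont)
  have dD: "(D has_field_derivative 0) (at z)" if z: "z \<in> ball 0 1 - {0}" for z
  proof -
    have 1: "(P has_field_derivative deriv P z) (at z)" "(P has_field_derivative deriv P (cnj z)) (at (cnj z))"
      using z by (auto intro!: holomorphic_derivI[OF P open_ball])
    have "deriv P z = (p z - 1) / z" "deriv P (cnj z) = (p (cnj z) - 1) / cnj z"
      using dP[of z] dP[of "cnj z"] z by (auto simp: field_simps)
    then have "cnj (deriv P (cnj z)) - deriv P z = 0" using sym[of z] z by simp
    then show ?thesis using DERIV_diff[OF has_field_derivative_cnj_cnj[OF 1(2)] 1(1)] by (simp add: D_def[abs_def] o_def)
  qed
  \<comment> \<open>The equation says nothing about \<open>deriv P 0\<close>, so 0 is an exceptional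
    point at which only the continuity of \<open>D\<close> is used.\<close>
  obtain c where c: "\<And>z. z \<in> ball 0 1 \<Longrightarrow> D z = c"
    using DERIV_zero_connected_constant[OF connected_ball open_ball _ contD, of "{0}"] dD by auto
  have "D z = D 0" using c[of z] c[of 0] z by simp
  then have "cnj (P (cnj z)) = P z" by (simp add: D_def P0)
  then show ?thesis by (metis complex_cnj_cnj)
qed

text \<open>On the ray in direction exp(i \<theta>), \<theta> + Im P is a continuous argument of z
  exp(P z). It is \<theta> > 0 at the origin and nonpositive at radius r, hence 0 at some point
  between. The value there is real, so by symmetry the conjugate point, a different one, has the
  same value.\<close>

lemma not_inj_if_argument_nonpos:
  assumes P: "continuous_on (ball 0 1) P" and P0: "P 0 = 0"
    and sym: "\<And>z. z \<in> ball 0 1 \<Longrightarrow> P (cnj z) = cnj (P z)"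
    and \<theta>: "0 < \<theta>" "Im (exp (\<i> * of_real \<theta>)) \<noteq> 0" and r: "0 \<le> r" "r < 1"
    and neg: "\<theta> + Im (P (of_real r * exp (\<i> * of_real \<theta>))) \<le> 0"
  shows "\<not> inj_on (\<lambda>z. z * exp (P z)) (ball 0 1)"
proof
  assume inj: "inj_on (\<lambda>z. z * exp (P z)) (ball 0 1)"
  define u where "u = exp (\<i> * of_real \<theta>)"
  have u: "cmod u = 1" by (simp add: u_def)
  have "\<exists>s. 0 \<le> s \<and> s \<le> r \<and> \<theta> + Im (P (of_real s * u)) = 0"
  proof (rule IVT2')
    show "continuous_on {0..r} (\<lambda>s. \<theta> + Im (P (of_real s * u)))"
      by (intro continuous_intros continuous_on_compose2[OF P]) (use r u in \<open>auto simp: norm_mult\<close>)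
  qed (use neg \<theta> r in \<open>auto simp: u_def P0\<close>)
  then obtain s where s: "0 \<le> s" "s \<le> r" "\<theta> + Im (P (of_real s * u)) = 0" by blast
  define z where "z = of_real s * u"
  have s0: "s \<noteq> 0" using s(3) \<theta>(1) P0 by auto
  have zb: "z \<in> ball 0 1" using s r u by (simp add: z_def norm_mult)
  have "z * exp (P z) = of_real s * exp (\<i> * of_real \<theta> + P z)" by (simp add: z_def u_def exp_add)
  also have "\<i> * of_real \<theta> + P z = of_real (Re (P z))" using s(3) by (simp add: z_def complex_eq_iff)
  finally have real: "z * exp (P z) = of_real (s * exp (Re (P z)))" by (simp add: exp_of_real)
  have "cnj z * exp (P (cnj z)) = cnj (z * exp (P z))" using sym[OF zb] by (simp add: exp_cnj)
  also have "\<dots> = z * exp (P z)" unfolding real by simp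
  finally have "cnj z = z" using inj zb by (auto dest: inj_onD)
  then have "Im z = 0" by (simp add: complex_eq_iff)
  then show False using s0 \<theta>(2) by (simp add: z_def u_def)
qed

section \<open>The map of the disc to the half-plane and the parametrised unit circle\<close>

text \<open>The maps below are explicit in terms of a single point e = spiral_centre on the unit circle.
  The circle is parametrised by the real number m for which the fractional linear map onto the right
  half-plane takes the value - i m, so that e corresponds to m = 0; circle_speed is the derivative
  of the argument with respect to m.\<close>

definition spiral_centre :: complex where "spiral_centre = Complex (4 / 5) (3 / 5)"

definition disc_to_half_plane :: "complex \<Rightarrow> complex" where
  "disc_to_half_plane z = - \<i> * (spiral_centre - z) / (1 - z * spiral_centre)"

definition circle_param :: "real \<Rightarrow> complex" where
  "circle_param m = (spiral_centre - of_real m) / (1 - of_real m * spiral_centre)"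

definition circle_speed :: "real \<Rightarrow> real" where
  "circle_speed m = (6 / 5) / (m\<^sup>2 - 8 / 5 * m + 1)"

definition spiral :: "real \<Rightarrow> complex \<Rightarrow> complex" where
  "spiral k z = of_real (exp (k * Im (Ln (disc_to_half_plane 0)))) * exp (\<i> * of_real k * Ln (disc_to_half_plane z))"

lemma spiral_centre_simps: "Re spiral_centre = 4 / 5" "Im spiral_centre = 3 / 5" "cmod spiral_centre = 1" "spiral_centre * cnj spiral_centre = 1"
  by (auto simp: spiral_centre_def cmod_def complex_eq_iff power2_eq_square)

lemma one_minus_spiral_centre_nonzero: "1 - z * spiral_centre \<noteq> 0" if "cmod z < 1"
proof
  assume "1 - z * spiral_centre = 0"
  then have "cmod (z * spiral_centre) = 1" by simp
  then show False using that by (simp add: norm_mult spiral_centre_simps)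
qed

text \<open>Multiplying by the conjugate denominator leaves the real part
  \<open>Im spiral_centre\<close> times 1 - |z|^2, because \<open>spiral_centre\<close> has modulus
  1.\<close>

lemma Re_disc_to_half_plane_pos:
  assumes z: "cmod z < 1" shows "Re (disc_to_half_plane z) > 0"
proof -
  have "(Re z)\<^sup>2 + (Im z)\<^sup>2 < 1" using z
    by (metis abs_norm_cancel abs_square_less_1 cmod_power2)
  then have "3 / 5 * (1 - ((Re z)\<^sup>2 + (Im z)\<^sup>2)) > 0" by simp
  moreover have "Re (- \<i> * (spiral_centre - z) * cnj (1 - z * spiral_centre)) = 3 / 5 * (1 - ((Re z)\<^sup>2 + (Im z)\<^sup>2))"
    by (simp add: spiral_centre_simps algebra_simps power2_eq_square)
  ultimately have "Re (- \<i> * (spiral_centre - z) * cnj (1 - z * spiral_centre)) > 0" by (simp only:)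
  then have "Re (- \<i> * (spiral_centre - z) * cnj (1 - z * spiral_centre) / of_real ((cmod (1 - z * spiral_centre))\<^sup>2)) > 0"
    using one_minus_spiral_centre_nonzero[OF z] by (simp only: Re_divide_of_real) simp
  then show ?thesis by (simp only: disc_to_half_plane_def complex_div_cnj[of _ "1 - z * spiral_centre"])
qed

text \<open>Conjugation exchanges the zero \<open>spiral_centre\<close> and the pole
  \<open>cnj spiral_centre\<close> of the map. On logarithms this amounts to a conjugation and a
  change of sign, which makes \<open>spiral\<close> commute with conjugation.\<close>

lemma disc_to_half_plane_cnj: "disc_to_half_plane (cnj z) = 1 / cnj (disc_to_half_plane z)" if z: "cmod z < 1"
proof -
  have aux: "- \<i> * x / y = 1 / (\<i> * x' / y')" if "x * x' = y' * y" "x' \<noteq> 0" "y \<noteq> 0" "y' \<noteq> 0" for x x' y y' :: complex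
    using that by (simp add: field_simps)
  have n: "1 - cnj z * spiral_centre \<noteq> 0" using one_minus_spiral_centre_nonzero[of "cnj z"] z by simp
  have n': "cnj spiral_centre - cnj z \<noteq> 0" using z spiral_centre_simps(3) by auto
  have n'': "1 - cnj z * cnj spiral_centre \<noteq> 0"
    using one_minus_spiral_centre_nonzero[OF z] complex_cnj_zero_iff[of "1 - z * spiral_centre"] by simp
  have "(spiral_centre - cnj z) * (cnj spiral_centre - cnj z) = (1 - cnj z * cnj spiral_centre) * (1 - cnj z * spiral_centre)"
    using spiral_centre_simps(4) by algebra
  then have "- \<i> * (spiral_centre - cnj z) / (1 - cnj z * spiral_centre) = 1 / (\<i> * (cnj spiral_centre - cnj z) / (1 - cnj z * cnj spiral_centre))"
    using aux n n' n'' by blast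
  then show ?thesis unfolding disc_to_half_plane_def by simp
qed

lemma circle_param_nonzero: "1 - of_real m * spiral_centre \<noteq> 0" "spiral_centre - of_real m \<noteq> 0"
  by (auto simp: complex_eq_iff spiral_centre_simps)

lemma disc_to_half_plane_circle_param: "disc_to_half_plane (circle_param m) = - \<i> * of_real m" "1 - circle_param m * spiral_centre \<noteq> 0"
proof -
  have e2: "1 - spiral_centre * spiral_centre \<noteq> 0" by (auto simp: complex_eq_iff spiral_centre_simps)
  have 1: "1 - circle_param m * spiral_centre = (1 - spiral_centre * spiral_centre) / (1 - of_real m * spiral_centre)"
    using circle_param_nonzero[of m] by (simp add: circle_param_def field_simps)
  have 2: "spiral_centre - circle_param m = of_real m * (1 - spiral_centre * spiral_centre) / (1 - of_real m * spiral_centre)"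
    using circle_param_nonzero[of m] by (simp add: circle_param_def field_simps)
  show "1 - circle_param m * spiral_centre \<noteq> 0" using e2 circle_param_nonzero[of m] by (simp add: 1)
  show "disc_to_half_plane (circle_param m) = - \<i> * of_real m"
    using e2 circle_param_nonzero[of m] unfolding disc_to_half_plane_def 1 2 by simp
qed

lemma norm_circle_param: "cmod (circle_param m) = 1"
proof -
  have "(cmod (spiral_centre - of_real m))\<^sup>2 = (cmod (1 - of_real m * spiral_centre))\<^sup>2"
    unfolding cmod_power2 by (simp add: spiral_centre_simps power2_eq_square algebra_simps)
  then have "cmod (spiral_centre - of_real m) = cmod (1 - of_real m * spiral_centre)" by simp
  then show ?thesis using circle_param_nonzero[of m] by (simp add: circle_param_def norm_divide)
qed

lemma circle_speed_denominator_pos: "m\<^sup>2 - 8 / 5 * m + 1 > (0::real)"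
proof -
  have "m\<^sup>2 - 8 / 5 * m + 1 = (m - 4 / 5)\<^sup>2 + 9 / 25" by (simp add: power2_eq_square algebra_simps)
  also have "\<dots> > 0" by (simp add: add_nonneg_pos)
  finally show ?thesis .
qed

lemma circle_speed_pos: "circle_speed m > 0"
  using circle_speed_denominator_pos[of m] by (simp add: circle_speed_def)

lemma continuous_circle_speed: "continuous_on S circle_speed"
  unfolding circle_speed_def using circle_speed_denominator_pos by (intro continuous_intros ballI less_imp_neq[THEN not_sym])

lemma circle_param_derivative: "(circle_param has_vector_derivative \<i> * of_real (circle_speed m) * circle_param m) (at m)"
proof -
  let ?m = "of_real m :: complex"
  have "((\<lambda>z. (spiral_centre - z) / (1 - z * spiral_centre)) has_field_derivative
      ((- 1) * (1 - ?m * spiral_centre) - (spiral_centre - ?m) * (- spiral_centre)) / ((1 - ?m * spiral_centre) * (1 - ?m * spiral_centre))) (at ?m)"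
    using circle_param_nonzero[of m] by (auto intro!: derivative_eq_intros)
  moreover have "((- 1) * (1 - ?m * spiral_centre) - (spiral_centre - ?m) * (- spiral_centre)) / ((1 - ?m * spiral_centre) * (1 - ?m * spiral_centre))
      = \<i> * of_real (circle_speed m) * circle_param m"
  proof -
    have aux: "(6 / 5) / (u * w / c) * w / u = (6 / 5) * c / (u * u)" if "u \<noteq> 0" "w \<noteq> 0" "c \<noteq> 0" for u w c :: complex
      using that by (simp add: field_simps)
    \<comment> \<open>Since \<open>spiral_centre\<close> has modulus 1, the quadratic factor is m^2
      - 2 m Re(spiral_centre) + 1. This is the source of 8/5; the 6/5 in the next identity is 2
      Im(spiral_centre).\<close>
    have d: "(1 - ?m * spiral_centre) * (spiral_centre - ?m) = spiral_centre * of_real (m\<^sup>2 - 8 / 5 * m + 1)"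
      by (simp add: complex_eq_iff spiral_centre_simps power2_eq_square algebra_simps)
    have n: "spiral_centre * spiral_centre - 1 = \<i> * (6 / 5) * spiral_centre"
      by (simp add: complex_eq_iff spiral_centre_simps)
    have a0: "spiral_centre \<noteq> 0" using spiral_centre_simps(3) by auto
    have "of_real (circle_speed m) * circle_param m = (6 / 5) / of_real (m\<^sup>2 - 8 / 5 * m + 1) * (spiral_centre - ?m) / (1 - ?m * spiral_centre)"
      by (simp add: circle_speed_def circle_param_def)
    also have "of_real (m\<^sup>2 - 8 / 5 * m + 1) = (1 - ?m * spiral_centre) * (spiral_centre - ?m) / spiral_centre"
      using d a0 by (simp add: field_simps)
    finally have "of_real (circle_speed m) * circle_param m = (6 / 5) * spiral_centre / ((1 - ?m * spiral_centre) * (1 - ?m * spiral_centre))"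
      using aux circle_param_nonzero[of m] a0 by (simp only:)
    then have "\<i> * of_real (circle_speed m) * circle_param m = (spiral_centre * spiral_centre - 1) / ((1 - ?m * spiral_centre) * (1 - ?m * spiral_centre))"
      unfolding n by (simp add: mult_ac)
    moreover have "(- 1) * (1 - ?m * spiral_centre) - (spiral_centre - ?m) * (- spiral_centre) = spiral_centre * spiral_centre - 1" by (simp add: algebra_simps)
    ultimately show ?thesis by simp
  qed
  ultimately have "((\<lambda>z. (spiral_centre - z) / (1 - z * spiral_centre)) has_field_derivative \<i> * of_real (circle_speed m) * circle_param m) (at ?m)"
    by (simp only:)
  then show ?thesis
    using has_vector_derivative_real_field[of "\<lambda>z. (spiral_centre - z) / (1 - z * spiral_centre)"] by (simp only: circle_param_def[abs_def])
qed

text \<open>The quotient \<open>E\<close> of the two sides has derivative 0 and is 1 at m = -1. The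
  integral is thus a continuous argument along the circle, counted from
  \<open>circle_param (-1) = 1\<close>.\<close>

lemma circle_param_argument:
  assumes "-1 \<le> m"
  shows "exp (\<i> * of_real (integral {-1..m} circle_speed)) = circle_param m"
proof -
  define Th where "Th x = integral {-1..x} circle_speed" for x
  define E where "E x = exp (- (\<i> * of_real (Th x))) * circle_param x" for x
  have dTh: "(Th has_vector_derivative circle_speed x) (at x within {-1..m})" if "x \<in> {-1..m}" for x
    unfolding Th_def by (rule integral_has_vector_derivative[OF continuous_circle_speed that])
  have "(E has_vector_derivative 0) (at x within {-1..m})" if x: "x \<in> {-1..m}" for x
  proof -
    have "((\<lambda>x. of_real (Th x)) has_vector_derivative (of_real (circle_speed x) :: complex)) (at x within {-1..m})"
      using bounded_linear.has_vector_derivative[OF bounded_linear_of_real dTh[OF x]] by simp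
    then have "((\<lambda>x. - (\<i> * of_real (Th x))) has_vector_derivative - (\<i> * of_real (circle_speed x))) (at x within {-1..m})"
      by (intro has_vector_derivative_minus has_vector_derivative_mult_right)
    then have "((exp \<circ> (\<lambda>x. - (\<i> * of_real (Th x)))) has_vector_derivative
        - (\<i> * of_real (circle_speed x)) * exp (- (\<i> * of_real (Th x)))) (at x within {-1..m})"
      by (rule field_vector_diff_chain_within) (auto intro: DERIV_exp[THEN has_field_derivative_at_within])
    then have "((\<lambda>x. exp (- (\<i> * of_real (Th x))) * circle_param x) has_vector_derivative
        exp (- (\<i> * of_real (Th x))) * (\<i> * of_real (circle_speed x) * circle_param x)
        + (- (\<i> * of_real (circle_speed x)) * exp (- (\<i> * of_real (Th x)))) * circle_param x) (at x within {-1..m})"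
      by (intro has_vector_derivative_mult has_vector_derivative_at_within[OF circle_param_derivative]) (simp add: o_def)
    then show ?thesis by (simp add: E_def[abs_def] algebra_simps)
  qed
  then obtain c where c: "\<And>x. x \<in> {-1..m} \<Longrightarrow> E x = c"
    using has_vector_derivative_zero_constant[of "{-1..m}" E] by auto
  have "circle_param (-1) = 1" using circle_param_nonzero[of "-1"] by (simp add: circle_param_def add.commute)
  then have "E (-1) = 1" by (simp add: E_def Th_def)
  then have "E m = 1" using c[of "-1"] c[of m] assms by simp
  then show ?thesis by (simp add: E_def Th_def exp_minus field_simps)
qed

section \<open>The function spiral: normalisation, symmetry, modulus, boundary values\<close>

text \<open>\<open>disc_to_half_plane 0 = - \<i> * spiral_centre\<close> lies on the unit circle. A
  positive prefactor in \<open>spiral\<close> therefore suffices to make its value at 0 equal to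
  1.\<close>

lemma Ln_disc_to_half_plane_0: "Ln (disc_to_half_plane 0) = \<i> * of_real (Im (Ln (disc_to_half_plane 0)))"
proof -
  have "cmod (disc_to_half_plane 0) = 1" by (simp add: disc_to_half_plane_def norm_mult spiral_centre_simps)
  then have "Re (Ln (disc_to_half_plane 0)) = 0" by (subst Re_Ln) auto
  then show ?thesis by (intro complex_eqI) simp_all
qed

lemma spiral_0: "spiral k 0 = 1"
proof -
  define \<beta> where "\<beta> = Im (Ln (disc_to_half_plane 0))"
  have "spiral k 0 = of_real (exp (k * \<beta>)) * exp (\<i> * of_real k * (\<i> * of_real \<beta>))"
    unfolding spiral_def by (subst Ln_disc_to_half_plane_0) (simp add: \<beta>_def)
  also have "\<i> * of_real k * (\<i> * of_real \<beta>) = of_real (- (k * \<beta>))" by (simp add: complex_eq_iff)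
  also have "exp (of_real (- (k * \<beta>))) = (of_real (exp (- (k * \<beta>))) :: complex)" by (rule exp_of_real)
  finally show ?thesis by (simp add: exp_minus)
qed

lemma holomorphic_spiral: "spiral k holomorphic_on ball 0 1"
proof -
  have "disc_to_half_plane holomorphic_on ball 0 1"
    unfolding disc_to_half_plane_def using one_minus_spiral_centre_nonzero by (intro holomorphic_intros) auto
  moreover have "disc_to_half_plane z \<notin> \<real>\<^sub>\<le>\<^sub>0" if "cmod z < 1" for z
    using Re_disc_to_half_plane_pos[OF that] by (auto simp: complex_nonpos_Reals_iff)
  ultimately show ?thesis
    unfolding spiral_def by (intro holomorphic_intros) auto
qed

lemma spiral_cnj: "spiral k (cnj z) = cnj (spiral k z)" if "z \<in> ball 0 1"
proof -
  have z: "cmod z < 1" using that by simp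
  have n: "disc_to_half_plane z \<notin> \<real>\<^sub>\<le>\<^sub>0" using Re_disc_to_half_plane_pos[OF z] by (auto simp: complex_nonpos_Reals_iff)
  have "Ln (disc_to_half_plane (cnj z)) = Ln (inverse (cnj (disc_to_half_plane z)))"
    using disc_to_half_plane_cnj[OF z] by (simp add: inverse_eq_divide)
  also have "\<dots> = - Ln (cnj (disc_to_half_plane z))" by (rule Ln_inverse) (use Re_disc_to_half_plane_pos[OF z] in \<open>auto simp: complex_nonpos_Reals_iff\<close>)
  also have "\<dots> = - cnj (Ln (disc_to_half_plane z))" using cnj_Ln[OF n] by simp
  finally show ?thesis by (simp add: spiral_def exp_cnj)
qed

text \<open>The modulus of exp(i k Ln N) depends only on the argument of N, which lies between -pi/2
  and pi/2.\<close>

lemma norm_spiral: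
  fixes k :: real
  assumes z: "cmod z < 1" and k: "k > 0"
  defines "C \<equiv> exp (k * Im (Ln (disc_to_half_plane 0)))"
  shows "cmod (spiral k z) \<le> C * exp (k * pi / 2)" "C * exp (- (k * pi / 2)) \<le> cmod (spiral k z)"
proof -
  have "\<bar>Im (Ln (disc_to_half_plane z))\<bar> < pi / 2"
    using Re_disc_to_half_plane_pos[OF z] Re_Ln_pos_lt[of "disc_to_half_plane z"] by (cases "disc_to_half_plane z = 0") auto
  then have "k * \<bar>Im (Ln (disc_to_half_plane z))\<bar> \<le> k * (pi / 2)" using k by (intro mult_left_mono) auto
  then have "\<bar>k * Im (Ln (disc_to_half_plane z))\<bar> \<le> k * pi / 2" using k by (simp add: abs_mult)
  moreover have "cmod (spiral k z) = C * exp (- (k * Im (Ln (disc_to_half_plane z))))"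
    by (simp add: spiral_def C_def norm_mult)
  ultimately show "cmod (spiral k z) \<le> C * exp (k * pi / 2)" "C * exp (- (k * pi / 2)) \<le> cmod (spiral k z)"
    by (auto simp: C_def abs_le_iff)
qed

text \<open>Radial boundary values of the real part of spiral k, up to a positive constant factor;
  at m = 0 there is no limit and the value 0 is arbitrary.\<close>

definition spiral_boundary :: "real \<Rightarrow> real \<Rightarrow> real" where
  "spiral_boundary k m = (if m = 0 then 0
     else (if m > 0 then exp (k * pi / 2) else exp (- (k * pi / 2))) * cos (k * ln \<bar>m\<bar>))"

text \<open>For m \<noteq> 0 the logarithm is continuous at - i m. Its imaginary part is -pi/2 for m
  > 0 and pi/2 for m < 0, whence the two exponential factors.\<close>

lemma spiral_radial_limit:
  assumes m: "m \<noteq> 0" and r: "r \<longlonglongrightarrow> (1::real)"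
  shows "(\<lambda>n. Re (spiral k (of_real (r n) * circle_param m))) \<longlonglongrightarrow> exp (k * Im (Ln (disc_to_half_plane 0))) * spiral_boundary k m"
proof -
  define C where "C = exp (k * Im (Ln (disc_to_half_plane 0)))"
  have "(\<lambda>n. of_real (r n) * circle_param m) \<longlonglongrightarrow> of_real 1 * circle_param m"
    by (intro tendsto_intros r)
  then have "(\<lambda>n. disc_to_half_plane (of_real (r n) * circle_param m)) \<longlonglongrightarrow> disc_to_half_plane (circle_param m)"
    unfolding disc_to_half_plane_def using disc_to_half_plane_circle_param(2)[of m] by (intro tendsto_intros) auto
  then have "(\<lambda>n. disc_to_half_plane (of_real (r n) * circle_param m)) \<longlonglongrightarrow> - \<i> * of_real m" by (simp add: disc_to_half_plane_circle_param)
  moreover have "- \<i> * of_real m \<notin> \<real>\<^sub>\<le>\<^sub>0" using m by (auto simp: complex_nonpos_Reals_iff)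
  ultimately have "(\<lambda>n. spiral k (of_real (r n) * circle_param m)) \<longlonglongrightarrow> of_real C * exp (\<i> * of_real k * Ln (- \<i> * of_real m))"
    unfolding spiral_def C_def by (intro tendsto_intros)
  then have "(\<lambda>n. Re (spiral k (of_real (r n) * circle_param m))) \<longlonglongrightarrow> Re (of_real C * exp (\<i> * of_real k * Ln (- \<i> * of_real m)))"
    by (rule tendsto_Re)
  moreover have "Re (of_real C * exp (\<i> * of_real k * Ln (- \<i> * of_real m))) = C * spiral_boundary k m"
  proof (cases "m > 0")
    case True
    have "Ln (- \<i> * of_real m) = of_real (ln m) - \<i> * (pi / 2)"
      using Ln_times_of_real[OF True, of "- \<i>"] True by (simp add: mult.commute Ln_of_real)
    then show ?thesis using True by (simp add: spiral_boundary_def Re_exp)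
  next
    case False
    then have m: "m < 0" using m by simp
    have "Ln (- \<i> * of_real m) = of_real (ln (- m)) + \<i> * (pi / 2)"
      using Ln_times_of_real[of "- m" "\<i>"] m Ln_of_real[of "- m"] by (simp add: mult.commute)
    then show ?thesis using m by (simp add: spiral_boundary_def Re_exp)
  qed
  ultimately show ?thesis by (simp add: C_def)
qed


section \<open>The argument of f along the boundary arc\<close>

text \<open>The parametrisation meets the real axis only at m = -1 and m = 1, where it takes the
  values 1 and -1.\<close>

lemma circle_param_nonreal:
  assumes "0 < v" "v < 1" shows "Im (circle_param v) \<noteq> 0"
proof
  assume 0: "Im (circle_param v) = 0"
  have "circle_param v = of_real (Re (circle_param v))" using 0 by (simp add: complex_eq_iff)
  moreover have "\<bar>Re (circle_param v)\<bar> = 1" using norm_circle_param[of v] 0 by (simp add: cmod_def)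
  ultimately have "circle_param v = 1 \<or> circle_param v = -1" by (metis abs_eq_iff abs_1 of_real_1 of_real_minus)
  then have "spiral_centre - of_real v = 1 - of_real v * spiral_centre \<or> spiral_centre - of_real v = - (1 - of_real v * spiral_centre)"
    using circle_param_nonzero[of v] by (auto simp: circle_param_def divide_eq_eq)
  then show False using assms by (auto simp: complex_eq_iff spiral_centre_simps)
qed

text \<open>On the circle of radius \<open>r n\<close> the argument of z exp(P z) is the integral of
  \<open>circle_speed\<close> times the real part of \<open>spiral\<close>. Dominated convergence,
  with the uniform bound on |spiral|, carries this to the unit circle.\<close>

lemma spiral_argument_limit:
  fixes k v :: real
  assumes k: "k > 0" and v: "0 < v" "v < 1"
    and P: "P holomorphic_on ball 0 1" and P0: "P 0 = 0"
    and dP: "\<And>z. z \<in> ball 0 1 \<Longrightarrow> z * deriv P z = spiral k z - 1"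
    and sym: "\<And>z. z \<in> ball 0 1 \<Longrightarrow> P (cnj z) = cnj (P z)"
  defines "r \<equiv> \<lambda>n. 1 - 1 / (real n + 2)" and "C \<equiv> exp (k * Im (Ln (disc_to_half_plane 0)))"
  shows "(\<lambda>m. circle_speed m * spiral_boundary k m) integrable_on {-1..v}"
    "(\<lambda>n. integral {-1..v} circle_speed + Im (P (of_real (r n) * circle_param v)))
      \<longlonglongrightarrow> C * integral {-1..v} (\<lambda>m. circle_speed m * spiral_boundary k m)"
proof -
  have r: "0 \<le> r n" "r n < 1" for n by (auto simp: r_def field_simps)
  have rlim: "r \<longlonglongrightarrow> 1"
  proof -
    have "(\<lambda>n. 1 - 1 / real (Suc (Suc n))) \<longlonglongrightarrow> 1 - 0"
      by (intro tendsto_intros LIMSEQ_Suc[OF LIMSEQ_Suc[OF lim_1_over_n]])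
    then show ?thesis by (simp add: r_def[abs_def] add.commute)
  qed
  have in_ball: "of_real (r n) * circle_param m \<in> ball 0 1" for n m
    using r[of n] by (simp add: norm_mult norm_circle_param)
  \<comment> \<open>At m = 0 there is no radial limit, so the integrand is set to 0 there, in
    agreement with \<open>spiral_boundary\<close>. A single point does not affect the
    integral.\<close>
  define F where "F n m = (if m = 0 then 0 else circle_speed m * Re (spiral k (of_real (r n) * circle_param m)))" for n m
  have FI: "(F n has_integral (integral {-1..v} circle_speed + Im (P (of_real (r n) * circle_param v)))) {-1..v}" for n
  proof -
    \<comment> \<open>The equation for \<open>deriv P\<close> gives a derivative i * speed * (spiral
      - 1) along the circle. The -1 later cancels against the argument of the circle point
      itself.\<close>
    have der: "((\<lambda>m. Im (P (of_real (r n) * circle_param m))) has_vector_derivative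
        circle_speed m * (Re (spiral k (of_real (r n) * circle_param m)) - 1)) (at m)" for m
    proof -
      let ?z = "of_real (r n) * circle_param m"
      have "((\<lambda>m. of_real (r n) * circle_param m) has_vector_derivative of_real (r n) * (\<i> * of_real (circle_speed m) * circle_param m)) (at m)"
        by (intro has_vector_derivative_mult_right circle_param_derivative)
      from field_vector_diff_chain_at[OF this holomorphic_derivI[OF P open_ball in_ball]]
      have "((\<lambda>m. P (of_real (r n) * circle_param m)) has_vector_derivative
          of_real (r n) * (\<i> * of_real (circle_speed m) * circle_param m) * deriv P ?z) (at m)" by (simp add: o_def)
      also have "of_real (r n) * (\<i> * of_real (circle_speed m) * circle_param m) * deriv P ?z = \<i> * of_real (circle_speed m) * (?z * deriv P ?z)"
        by (simp only: mult_ac)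
      also have "\<dots> = \<i> * of_real (circle_speed m) * (spiral k ?z - 1)" using dP[OF in_ball] by simp
      finally have "((\<lambda>m. P (of_real (r n) * circle_param m)) has_vector_derivative \<i> * of_real (circle_speed m) * (spiral k ?z - 1)) (at m)" .
      from bounded_linear.has_vector_derivative[OF bounded_linear_Im this]
      show ?thesis by simp
    qed
    have h1: "((\<lambda>m. circle_speed m * (Re (spiral k (of_real (r n) * circle_param m)) - 1)) has_integral
        (Im (P (of_real (r n) * circle_param v)) - Im (P (of_real (r n) * circle_param (-1))))) {-1..v}"
      using v by (intro fundamental_theorem_of_calculus has_vector_derivative_at_within[OF der]) auto
    \<comment> \<open>The arc starts on the real axis, where \<open>P\<close> is real by
      symmetry.\<close>
    have h2: "Im (P (of_real (r n) * circle_param (-1))) = 0"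
    proof -
      have a1: "circle_param (-1) = 1" using circle_param_nonzero[of "-1"] by (simp add: circle_param_def add.commute)
      have "P (of_real (r n)) = cnj (P (of_real (r n)))" using sym[of "of_real (r n)"] r[of n] by simp
      then show ?thesis by (simp add: a1 complex_eq_iff)
    qed
    have h3: "(circle_speed has_integral integral {-1..v} circle_speed) {-1..v}"
      by (intro integrable_integral integrable_continuous_interval continuous_circle_speed)
    have "((\<lambda>m. circle_speed m + circle_speed m * (Re (spiral k (of_real (r n) * circle_param m)) - 1)) has_integral
        (integral {-1..v} circle_speed + Im (P (of_real (r n) * circle_param v)))) {-1..v}"
      using has_integral_add[OF h3 h1] unfolding h2 by simp
    then show ?thesis
      by (rule has_integral_spike[of "{0}", rotated 2]) (auto simp: F_def algebra_simps)
  qed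
  have int: "integral {-1..v} (F n) = integral {-1..v} circle_speed + Im (P (of_real (r n) * circle_param v))" for n
    using FI by (rule integral_unique)
  have bound: "norm (F n m) \<le> circle_speed m * (C * exp (k * pi / 2))" for n m
  proof -
    have "\<bar>Re (spiral k (of_real (r n) * circle_param m))\<bar> \<le> C * exp (k * pi / 2)"
      using order_trans[OF abs_Re_le_cmod norm_spiral(1)[OF _ k]] in_ball by (simp add: C_def)
    then show ?thesis using circle_speed_pos[of m] by (auto simp: F_def abs_mult C_def intro!: mult_left_mono)
  qed
  have conv: "(\<lambda>n. F n m) \<longlonglongrightarrow> circle_speed m * (C * spiral_boundary k m)" for m
  proof (cases "m = 0")
    case True then show ?thesis by (simp add: F_def spiral_boundary_def)
  next
    case False
    then show ?thesis
      using tendsto_mult[OF tendsto_const spiral_radial_limit[OF False rlim, of k]] by (simp add: F_def C_def)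
  qed
  have hI: "(\<lambda>m. circle_speed m * (C * exp (k * pi / 2))) integrable_on {-1..v}"
    by (intro integrable_continuous_interval continuous_intros continuous_circle_speed)
  note dc = dominated_convergence[of F "{-1..v}", OF _ hI bound conv]
  have 1: "(\<lambda>m. circle_speed m * (C * spiral_boundary k m)) integrable_on {-1..v}"
    and 2: "(\<lambda>n. integral {-1..v} (F n)) \<longlonglongrightarrow> integral {-1..v} (\<lambda>m. circle_speed m * (C * spiral_boundary k m))"
    using dc FI by (auto simp: integrable_on_def)
  have eq: "(\<lambda>m. circle_speed m * (C * spiral_boundary k m)) = (\<lambda>m. C * (circle_speed m * spiral_boundary k m))" by (simp add: fun_eq_iff)
  show "(\<lambda>m. circle_speed m * spiral_boundary k m) integrable_on {-1..v}"
    using integrable_on_mult_right[OF 1[unfolded eq], of "1 / C"] by (simp add: C_def)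
  show "(\<lambda>n. integral {-1..v} circle_speed + Im (P (of_real (r n) * circle_param v)))
      \<longlonglongrightarrow> C * integral {-1..v} (\<lambda>m. circle_speed m * spiral_boundary k m)"
    using 2 unfolding int eq by simp
qed

text \<open>\<open>neg\<close> is conditional because integrability is only delivered by the
  dominated convergence. A negative limit yields a radius below 1 with negative argument, so the
  function is not univalent although \<open>Lf\<close> is at most exp(k pi) times \<open>lf\<close>.
  Hence no \<open>\<delta> \<ge> k * pi\<close> is admissible.\<close>

lemma delta1_le_if_argument_negative:
  fixes k v :: real
  assumes k: "k > 0" and v: "0 < v" "v < 1"
    and neg: "(\<lambda>m. circle_speed m * spiral_boundary k m) integrable_on {-1..v} \<Longrightarrow> integral {-1..v} (\<lambda>m. circle_speed m * spiral_boundary k m) < 0"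
  shows "delta1 \<le> ereal (k * pi)"
proof -
  obtain P where P: "P holomorphic_on ball 0 1" "P 0 = 0"
      "\<And>z. z \<in> ball 0 1 \<Longrightarrow> z * deriv P z = spiral k z - 1"
    and f: "(\<lambda>z. z * exp (P z)) \<in> classA"
    and zq: "\<And>z. z \<in> ball 0 1 \<Longrightarrow> zq (\<lambda>z. z * exp (P z)) z = spiral k z"
    and dom: "dom_q (\<lambda>z. z * exp (P z)) = ball 0 1"
    using classA_with_prescribed_zq[OF holomorphic_spiral spiral_0] by blast
  have sym: "P (cnj z) = cnj (P z)" if "z \<in> ball 0 1" for z
    using primitive_real_symmetric[OF P spiral_cnj that] .
  define C where "C = exp (k * Im (Ln (disc_to_half_plane 0)))"
  define f where "f z = z * exp (P z)" for z
  have "C * integral {-1..v} (\<lambda>m. circle_speed m * spiral_boundary k m) < 0"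
    using neg[OF spiral_argument_limit(1)[OF k v P sym]] by (simp add: C_def mult_pos_neg)
  then have "\<forall>\<^sub>F n in sequentially. integral {-1..v} circle_speed + Im (P (of_real (1 - 1 / (real n + 2)) * circle_param v)) < 0"
    using spiral_argument_limit(2)[OF k v P sym] unfolding C_def by (rule order_tendstoD(2)[rotated])
  then obtain n where n: "integral {-1..v} circle_speed + Im (P (of_real (1 - 1 / (real n + 2)) * circle_param v)) < 0"
    by (meson eventually_happens' sequentially_bot)
  have arc: "exp (\<i> * of_real (integral {-1..v} circle_speed)) = circle_param v" using circle_param_argument[of v] v by simp
  have noninj: "\<not> inj_on f (ball 0 1)"
    unfolding f_def
  proof (rule not_inj_if_argument_nonpos)
    show "continuous_on (ball 0 1) P" using P(1) by (rule holomorphic_on_imp_continuous_on)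
    have "integral {-1..v} circle_speed \<noteq> 0"
      using arc circle_param_nonreal[OF v] by auto
    moreover have "integral {-1..v} circle_speed \<ge> 0"
      using circle_speed_pos by (intro integral_nonneg integrable_continuous_interval continuous_circle_speed) (auto intro: less_imp_le)
    ultimately show "0 < integral {-1..v} circle_speed" by simp
    show "Im (exp (\<i> * of_real (integral {-1..v} circle_speed))) \<noteq> 0" using arc circle_param_nonreal[OF v] by simp
    show "integral {-1..v} circle_speed + Im (P (of_real (1 - 1 / (real n + 2)) * exp (\<i> * of_real (integral {-1..v} circle_speed)))) \<le> 0"
      using n arc by simp
  qed (use P sym in \<open>auto simp: field_simps\<close>)
  have L: "Lf f \<le> ereal (C * exp (k * pi / 2))"
    unfolding Lf_def using dom zq norm_spiral(1)[OF _ k]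
    by (intro SUP_least) (auto simp: f_def[abs_def] C_def)
  have l: "lf f \<ge> ereal (C * exp (- (k * pi / 2)))"
    unfolding lf_def using dom zq norm_spiral(2)[OF _ k]
    by (intro INF_greatest) (auto simp: f_def[abs_def] C_def)
  have bad: "Lf f \<le> ereal (exp \<delta>) * lf f" if \<delta>: "\<delta> \<ge> k * pi" for \<delta>
  proof -
    have "C * exp (k * pi / 2) = exp (k * pi) * (C * exp (- (k * pi / 2)))"
      by (simp add: exp_add[symmetric] mult.left_commute)
    also have "\<dots> \<le> exp \<delta> * (C * exp (- (k * pi / 2)))"
      using \<delta> by (intro mult_right_mono) (auto simp: C_def)
    finally have "ereal (C * exp (k * pi / 2)) \<le> ereal (exp \<delta>) * ereal (C * exp (- (k * pi / 2)))" by simp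
    also have "\<dots> \<le> ereal (exp \<delta>) * lf f" using l by (intro ereal_mult_left_mono) auto
    finally show ?thesis using L order_trans by blast
  qed
  show ?thesis unfolding delta1_def
  proof (rule Sup_least)
    fix x assume "x \<in> {ereal \<delta> | \<delta>. \<delta> > 0 \<and> (\<forall>f \<in> classA. Lf f \<le> ereal (exp \<delta>) * lf f \<longrightarrow> inj_on f (ball 0 1))}"
    then obtain \<delta> where \<delta>: "x = ereal \<delta>" "\<And>f. f \<in> classA \<Longrightarrow> Lf f \<le> ereal (exp \<delta>) * lf f \<Longrightarrow> inj_on f (ball 0 1)"
      by blast
    have "f \<in> classA" using f by (simp add: f_def[abs_def])
    then have "\<not> \<delta> \<ge> k * pi" using \<delta>(2) bad noninj by blast
    then show "x \<le> ereal (k * pi)" using \<delta>(1) by simp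
  qed
qed

section \<open>Numerical estimate of the boundary integral for k = 71/100\<close>

text \<open>These are bounds for exp(-k pi) and exp(-pi/(2k)). The exponents satisfy k pi \<ge>
  2.2294 and 2.2 \<le> pi/(2k) \<le> 2.2124; a summand 2 is handled by the square of e, and the
  small remainder by polynomial bounds.\<close>

lemma exp_pi_numerics:
  "exp (- (71 / 100 * pi)) \<le> (1085 / 10000 :: real)"
  "108 / 1000 \<le> exp (- (pi / (2 * (71 / 100 :: real))))" "exp (- (pi / (2 * (71 / 100 :: real)))) \<le> 115 / 1000"
proof -
  have e: "2.718 \<le> exp (1::real)" "exp (1::real) \<le> 2.7183"
  proof -
    have "\<bar>exp 1 - 5837465777 / 2147483648 :: real\<bar> \<le> 1 / 4294967296" using e_approx_32 by simp
    then have "exp 1 - 5837465777 / 2147483648 \<le> (1 / 4294967296 :: real)"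
        "- (exp 1 - 5837465777 / 2147483648) \<le> (1 / 4294967296 :: real)" unfolding abs_le_iff by blast+
    then show "2.718 \<le> exp (1::real)" "exp (1::real) \<le> 2.7183" by simp_all
  qed
  have e2: "exp (2::real) = exp 1 * exp 1" by (simp add: exp_add[symmetric])
  have e2l: "7.387 \<le> exp (2::real)" unfolding e2 using mult_mono[OF e(1) e(1)] by simp
  have e2u: "exp (2::real) \<le> 7.3892" unfolding e2 using mult_mono[OF e(2) e(2)] by simp
  have "9.217 \<le> 7.387 * (1.2555::real)" by simp
  also have "\<dots> \<le> exp 2 * exp (0.2294::real)"
  proof (intro mult_mono e2l)
    have "1.2555 \<le> 1 + 0.2294 + (0.2294::real)\<^sup>2 / 2" by (simp add: power2_eq_square)
    also have "\<dots> \<le> exp 0.2294" by (rule exp_lower_Taylor_quadratic) simp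
    finally show "1.2555 \<le> exp (0.2294::real)" .
  qed auto
  also have "\<dots> = exp 2.2294" by (simp add: exp_add[symmetric])
  also have "\<dots> \<le> exp (71 / 100 * pi)" using pi_approx by simp
  finally have "9.217 \<le> exp (71 / 100 * pi)" .
  then show "exp (- (71 / 100 * pi)) \<le> (1085 / 10000 :: real)"
    unfolding exp_minus by (simp add: inverse_eq_divide divide_le_eq)
  have "exp (pi / (2 * (71 / 100 :: real))) \<le> exp (2.2124::real)" using pi_approx by simp
  \<comment> \<open>The remainder 0.2124 is halved because squaring the quadratic bound at 0.1062 is
    sharper; the bound at 0.2124 itself would miss 9.25.\<close>
  also have "\<dots> = exp 2 * (exp 0.1062 * exp (0.1062::real))" by (simp add: exp_add[symmetric])
  also have "\<dots> \<le> 7.3892 * (1.1175 * 1.1175)"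
  proof (intro mult_mono e2u)
    have "exp (0.1062::real) \<le> 1 + 0.1062 + 0.1062\<^sup>2" by (rule exp_bound) auto
    also have "\<dots> \<le> 1.1175" by (simp add: power2_eq_square)
    finally show "exp (0.1062::real) \<le> 1.1175" "exp (0.1062::real) \<le> 1.1175" by auto
  qed auto
  also have "\<dots> \<le> 9.25" by simp
  finally have "exp (pi / (2 * (71 / 100 :: real))) \<le> 9.25" .
  then have "1 / 9.25 \<le> 1 / exp (pi / (2 * (71 / 100 :: real)))" by (intro divide_left_mono) auto
  then show "108 / 1000 \<le> exp (- (pi / (2 * (71 / 100 :: real))))" unfolding exp_minus inverse_eq_divide by simp
  have "8.7 \<le> 7.387 * (1.2::real)" by simp
  also have "\<dots> \<le> exp 2 * exp (0.2::real)" using exp_ge_add_one_self[of "0.2::real"] by (intro mult_mono e2l) auto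
  also have "\<dots> = exp 2.2" by (simp add: exp_add[symmetric])
  also have "\<dots> \<le> exp (pi / (2 * (71 / 100 :: real)))" using pi_approx by simp
  finally have "1 / exp (pi / (2 * (71 / 100 :: real))) \<le> 1 / 8.7" by (intro divide_left_mono) auto
  then show "exp (- (pi / (2 * (71 / 100 :: real)))) \<le> 115 / 1000" unfolding exp_minus inverse_eq_divide by simp
qed

text \<open>\<open>v\<close> and \<open>v ^ 3\<close> are consecutive zeros of cos(k ln m), which is
  nonpositive between them, so [v^3, v] supplies the decisive negative term. For m < 0 the integrand
  carries the small extra factor exp(-k pi), and the infinitely many oscillations with |m| < v^3 are
  met by cos \<le> 1.\<close>

lemma boundary_argument_bound:
  fixes k v :: real
  assumes k: "k > 0" and v: "v = exp (- (pi / (2 * k)))" "v \<le> 115 / 1000"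
    and int: "(\<lambda>m. circle_speed m * spiral_boundary k m) integrable_on {-1..v}"
  shows "integral {-1..v} (\<lambda>m. circle_speed m * spiral_boundary k m) \<le> 6 / 5 * exp (k * pi / 2) *
    (exp (- (k * pi)) * (10 / 9 * (1 / (1 + v) - 1 / 2)) + exp (- (k * pi)) * v ^ 3
      + 101 / 100 * v ^ 3 - (v + v ^ 3) * k / (1 + k\<^sup>2))"
proof -
  define G where "G m = circle_speed m * spiral_boundary k m" for m
  define D where "D m = m\<^sup>2 - 8 / 5 * m + 1" for m :: real
  define c where "c = 6 / 5 * exp (k * pi / 2)"
  define E where "E = exp (- (k * pi))"
  have D: "D m > 0" for m using circle_speed_denominator_pos[of m] by (simp add: D_def)
  have c: "c > 0" and E: "E > 0" by (auto simp: c_def E_def)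
  have cE: "6 / 5 * exp (- (k * pi / 2)) = c * E"
    by (simp add: c_def E_def exp_add[symmetric])
  have Gp: "G m = c * (cos (k * ln m) / D m)" if "m > 0" for m
    using that by (simp add: G_def circle_speed_def spiral_boundary_def D_def c_def)
  have Gn: "G m = c * (E * (cos (k * ln (- m)) / D m))" if "m < 0" for m
  proof -
    have "G m = (6 / 5 * exp (- (k * pi / 2))) * (cos (k * ln (- m)) / D m)"
      using that by (simp add: G_def circle_speed_def spiral_boundary_def D_def)
    then show ?thesis unfolding cE by (simp only: mult.assoc)
  qed
  have v0: "0 < v" using v by simp
  have v3: "0 < v ^ 3" "v ^ 3 \<le> v" "v ^ 3 \<le> 1 / 500"
  proof -
    show "0 < v ^ 3" using v0 by simp
    have "v ^ 3 \<le> v ^ 1" using v0 v(2) by (intro power_decreasing) auto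
    then show "v ^ 3 \<le> v" by simp
    have "v ^ 3 \<le> (115 / 1000) ^ 3" using v0 v by (intro power_mono) auto
    then show "v ^ 3 \<le> 1 / 500" by (simp add: power_divide)
  qed
  have lnv: "k * ln v = - (pi / 2)" using v k by simp
  have lnv3: "k * ln (v ^ 3) = - (3 * pi / 2)" using lnv v0 by (simp add: ln_realpow)
  have cos_np: "cos (k * ln m) \<le> 0" if "v ^ 3 \<le> m" "m \<le> v" for m
  proof -
    have "0 < m" using that v3(1) by linarith
    then have "ln (v ^ 3) \<le> ln m" "ln m \<le> ln v" using that v3(1) v0 ln_mono by blast+
    then have "k * ln (v ^ 3) \<le> k * ln m" "k * ln m \<le> k * ln v" using k by auto
    then have "- (3 * pi / 2) \<le> k * ln m" "k * ln m \<le> - (pi / 2)" using lnv lnv3 by auto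
    then have "cos (k * ln m + pi) \<ge> 0" by (intro cos_ge_zero) auto
    then show ?thesis by simp
  qed
  have GI: "G integrable_on {a..b}" if "-1 \<le> a" "b \<le> v" for a b
    using int that unfolding G_def[abs_def] by (rule_tac integrable_on_subinterval) auto
  have upper: "integral {a..b} G \<le> I" if "-1 \<le> a" "b \<le> v" "(B has_integral I) {a..b}"
      "\<And>m. m \<in> {a..b} \<Longrightarrow> G m \<le> B m" for a b B I
    using has_integral_le[OF integrable_integral[OF GI[OF that(1,2)]] that(3,4)] .
  \<comment> \<open>Here cos \<le> 1, and the denominator is replaced by 0.9 (1 - m)^2, which has an
    elementary primitive after inversion and touches \<open>D\<close> at m = -1.\<close>
  have 1: "integral {-1..-v} G \<le> c * (E * (10 / 9 * (1 / (1 + v) - 1 / 2)))"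
  proof (rule upper)
    have "((\<lambda>m. 1 / (1 - m)\<^sup>2) has_integral (1 / (1 - (- v)) - 1 / (1 - (-1)))) {-1..-v}"
    proof (rule fundamental_theorem_of_calculus)
      fix m assume "m \<in> {-1..-v}"
      then have "m < 1" using v0 by simp
      then show "((\<lambda>m. 1 / (1 - m)) has_vector_derivative 1 / (1 - m)\<^sup>2) (at m within {-1..-v})"
        unfolding has_real_derivative_iff_has_vector_derivative[symmetric]
        by (auto intro!: derivative_eq_intros simp: power2_eq_square)
    qed (use v(2) in auto)
    then have "((\<lambda>m. 1 / (1 - m)\<^sup>2) has_integral (1 / (1 + v) - 1 / 2)) {-1..-v}" by simp
    then show "((\<lambda>m. c * (E * (10 / 9 * (1 / (1 - m)\<^sup>2)))) has_integral c * (E * (10 / 9 * (1 / (1 + v) - 1 / 2)))) {-1..-v}"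
      by (intro has_integral_mult_right)
    fix m assume m: "m \<in> {-1..-v}"
    have "9 / 10 * (1 - m)\<^sup>2 \<le> D m"
    proof -
      have "D m - 9 / 10 * (1 - m)\<^sup>2 = 1 / 10 * (m + 1)\<^sup>2"
        by (simp add: D_def power2_eq_square field_simps)
      moreover have "1 / 10 * (m + 1)\<^sup>2 \<ge> 0" by simp
      ultimately show ?thesis by linarith
    qed
    then have "cos (k * ln (- m)) / D m \<le> 1 / (9 / 10 * (1 - m)\<^sup>2)"
      using m v0 D[of m] by (intro frac_le) auto
    then have "cos (k * ln (- m)) / D m \<le> 10 / 9 * (1 / (1 - m)\<^sup>2)" by simp
    then have "c * (E * (cos (k * ln (- m)) / D m)) \<le> c * (E * (10 / 9 * (1 / (1 - m)\<^sup>2)))"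
      using c E by (intro mult_left_mono less_imp_le[OF c] less_imp_le[OF E])
    moreover have "m < 0" using m v0 by simp
    ultimately show "G m \<le> c * (E * (10 / 9 * (1 / (1 - m)\<^sup>2)))" using Gn by metis
  qed (use v0 in auto)
  \<comment> \<open>The cosine is nonpositive here; the gain is only of order \<open>E\<close> and
    is dropped.\<close>
  have 2: "integral {-v..- (v ^ 3)} G \<le> 0"
  proof (rule upper)
    show "((\<lambda>_. 0) has_integral 0) {- v..- (v ^ 3)}" by simp
    fix m assume m: "m \<in> {- v..- (v ^ 3)}"
    have "cos (k * ln (- m)) \<le> 0" using cos_np[of "- m"] m by auto
    then have "cos (k * ln (- m)) / D m \<le> 0" using D[of m] by (simp add: divide_nonpos_pos)
    then have "c * (E * (cos (k * ln (- m)) / D m)) \<le> 0"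
      using c E by (intro mult_nonneg_nonpos less_imp_le[OF c] less_imp_le[OF E])
    moreover have "m < 0" using m v3(1) unfolding atLeastAtMost_iff by linarith
    ultimately show "G m \<le> 0" using Gn by metis
  qed (use v(2) v0 v3 in \<open>linarith+\<close>)
  have 3: "integral {- (v ^ 3)..0} G \<le> c * (E * v ^ 3)"
  proof (rule upper)
    show "((\<lambda>_. c * E) has_integral c * (E * v ^ 3)) {- (v ^ 3)..0}"
      using has_integral_const_real[of "c * E" "- (v ^ 3)" 0] v3 by (simp add: mult_ac)
    fix m assume m: "m \<in> {- (v ^ 3)..0}"
    show "G m \<le> c * E"
    proof (cases "m = 0")
      case True then show ?thesis using c E by (simp add: G_def spiral_boundary_def)
    next
      case False
      have "1 \<le> D m" using m zero_le_power2[of m] unfolding D_def atLeastAtMost_iff by linarith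
      then have "cos (k * ln (- m)) / D m \<le> 1 / 1" by (intro frac_le) auto
      then have "E * (cos (k * ln (- m)) / D m) \<le> E * 1" using E by (intro mult_left_mono) auto
      then have "c * (E * (cos (k * ln (- m)) / D m)) \<le> c * (E * 1)"
        by (rule mult_left_mono) (use c in simp)
      moreover have "m < 0" using m False by simp
      ultimately show ?thesis using Gn by (metis mult.right_neutral)
    qed
  qed (use v(2) v0 v3 in \<open>linarith+\<close>)
  have 4: "integral {0..v ^ 3} G \<le> c * (101 / 100 * v ^ 3)"
  proof (rule upper)
    show "((\<lambda>_. c * (101 / 100)) has_integral c * (101 / 100 * v ^ 3)) {0..v ^ 3}"
      using has_integral_const_real[of "c * (101 / 100)" 0 "v ^ 3"] v3 by (simp add: mult_ac)
    fix m assume m: "m \<in> {0..v ^ 3}"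
    show "G m \<le> c * (101 / 100)"
    proof (cases "m = 0")
      case True then show ?thesis using c by (simp add: G_def spiral_boundary_def)
    next
      case False
      have "m \<le> 1 / 500" using m v3(3) unfolding atLeastAtMost_iff by linarith
      \<comment> \<open>With m \<le> 1/500 the linear term costs at most 8/2500.\<close>
      then have "100 / 101 \<le> D m" using zero_le_power2[of m] unfolding D_def by linarith
      then have "cos (k * ln m) / D m \<le> 1 / (100 / 101)" by (intro frac_le) auto
      then have "c * (cos (k * ln m) / D m) \<le> c * (1 / (100 / 101))"
        by (rule mult_left_mono) (use c in simp)
      moreover have "m > 0" using m False by simp
      ultimately show ?thesis using Gp[of m] by simp
    qed
  qed (use v(2) v0 v3 in \<open>linarith+\<close>)
  \<comment> \<open>The cosine is nonpositive and 0 < D \<le> 1, so removing the denominator can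
    only raise the integrand. What remains is cos(k ln m), with the explicit primitive
    \<open>A\<close>.\<close>
  have 5: "integral {v ^ 3..v} G \<le> c * (- ((v + v ^ 3) * k / (1 + k\<^sup>2)))"
  proof (rule upper)
    define A where "A m = m * (cos (k * ln m) + k * sin (k * ln m)) / (1 + k\<^sup>2)" for m
    have k2: "1 + k\<^sup>2 > 0" by (simp add: add_pos_nonneg)
    have "((\<lambda>m. cos (k * ln m)) has_integral A v - A (v ^ 3)) {v ^ 3..v}"
    proof (rule fundamental_theorem_of_calculus)
      fix m assume "m \<in> {v ^ 3..v}"
      then have m: "m > 0" using v3(1) unfolding atLeastAtMost_iff by linarith
      have "(A has_real_derivative (1 * (cos (k * ln m) + k * sin (k * ln m))
          + m * (- sin (k * ln m) * (k * (1 / m)) + k * (cos (k * ln m) * (k * (1 / m))))) / (1 + k\<^sup>2)) (at m)"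
        unfolding A_def using m k2 by (auto intro!: derivative_eq_intros)
      moreover have "(1 * (cos (k * ln m) + k * sin (k * ln m))
          + m * (- sin (k * ln m) * (k * (1 / m)) + k * (cos (k * ln m) * (k * (1 / m))))) = (1 + k\<^sup>2) * cos (k * ln m)"
        using m by (simp add: field_simps power2_eq_square)
      ultimately have "(A has_real_derivative cos (k * ln m)) (at m)" using k2 by simp
      then show "(A has_vector_derivative cos (k * ln m)) (at m within {v ^ 3..v})"
        unfolding has_real_derivative_iff_has_vector_derivative[symmetric] by (rule has_field_derivative_at_within)
    qed (use v3 in simp)
    moreover have "A v = - (v * k / (1 + k\<^sup>2))" by (simp add: A_def lnv)
    moreover have "A (v ^ 3) = v ^ 3 * k / (1 + k\<^sup>2)"
    proof -
      have "3 * pi / 2 = 3 / 2 * pi" by simp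
      then have "sin (3 * pi / 2) = - 1" "cos (3 * pi / 2) = 0" using sin_3over2_pi cos_3over2_pi by metis+
      then show ?thesis unfolding A_def lnv3 by simp
    qed
    ultimately have "((\<lambda>m. cos (k * ln m)) has_integral - ((v + v ^ 3) * k / (1 + k\<^sup>2))) {v ^ 3..v}"
      by (simp add: add_divide_distrib algebra_simps)
    then show "((\<lambda>m. c * cos (k * ln m)) has_integral c * (- ((v + v ^ 3) * k / (1 + k\<^sup>2)))) {v ^ 3..v}"
      by (rule has_integral_mult_right)
    fix m assume m: "m \<in> {v ^ 3..v}"
    have "m > 0" using m v3(1) unfolding atLeastAtMost_iff by linarith
    have "m * m \<le> 8 / 5 * m" using m v(2) \<open>m > 0\<close> by (intro mult_right_mono) auto
    then have "D m \<le> 1" by (simp add: D_def power2_eq_square)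
    then have "cos (k * ln m) / D m \<le> cos (k * ln m)"
      using cos_np[of m] m D[of m] by (auto simp: divide_le_eq mult_le_cancel_left1)
    then have "c * (cos (k * ln m) / D m) \<le> c * cos (k * ln m)"
      by (rule mult_left_mono) (use c in simp)
    then show "G m \<le> c * cos (k * ln m)" using Gp \<open>m > 0\<close> by metis
  qed (use v(2) v0 v3 in \<open>linarith+\<close>)
  have split: "integral {a..v} G = integral {a..b} G + integral {b..v} G" if "-1 \<le> a" "a \<le> b" "b \<le> v" for a b
    using Henstock_Kurzweil_Integration.integral_combine[OF that(2,3) GI[OF that(1) order_refl]] by simp
  have "integral {-1..v} G = integral {-1..-v} G + integral {-v..- (v ^ 3)} G + integral {- (v ^ 3)..0} G
      + integral {0..v ^ 3} G + integral {v ^ 3..v} G"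
    using split[of "-1" "-v"] split[of "-v" "- (v ^ 3)"] split[of "- (v ^ 3)" 0] split[of 0 "v ^ 3"] v(2) v0 v3
    by linarith
  also have "\<dots> \<le> c * (E * (10 / 9 * (1 / (1 + v) - 1 / 2))) + 0 + c * (E * v ^ 3) + c * (101 / 100 * v ^ 3)
      + c * (- ((v + v ^ 3) * k / (1 + k\<^sup>2)))"
    by (intro add_mono 1 2 3 4 5)
  also have "\<dots> = c * (E * (10 / 9 * (1 / (1 + v) - 1 / 2)) + E * v ^ 3 + 101 / 100 * v ^ 3 - (v + v ^ 3) * k / (1 + k\<^sup>2))"
    by (simp only: distrib_left right_diff_distrib)
  finally show ?thesis unfolding G_def c_def E_def .
qed

text \<open>The choice k = 0.71 stays below 5/7 = 0.714..., which gives strictness, and still leaves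
  the boundary integral negative.\<close>

lemma delta1_upper: "delta1 < ereal (5 * pi / 7)"
proof -
  define k :: real where "k = 71 / 100"
  define v where "v = exp (- (pi / (2 * k)))"
  define E where "E = exp (- (k * pi))"
  have E: "0 < E" "E \<le> 1085 / 10000" using exp_pi_numerics(1) by (auto simp: E_def k_def)
  have v: "108 / 1000 \<le> v" "v \<le> 115 / 1000" using exp_pi_numerics(2,3) by (auto simp: v_def k_def)
  have "delta1 \<le> ereal (k * pi)"
  proof (rule delta1_le_if_argument_negative)
    assume "(\<lambda>m. circle_speed m * spiral_boundary k m) integrable_on {-1..v}"
    then have "integral {-1..v} (\<lambda>m. circle_speed m * spiral_boundary k m) \<le> 6 / 5 * exp (k * pi / 2) *
      (E * (10 / 9 * (1 / (1 + v) - 1 / 2)) + E * v ^ 3 + 101 / 100 * v ^ 3 - (v + v ^ 3) * k / (1 + k\<^sup>2))"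
      unfolding E_def by (intro boundary_argument_bound) (use v in \<open>auto simp: v_def k_def\<close>)
    also have "\<dots> < 0"
    proof (rule mult_pos_neg)
      \<comment> \<open>7100/15041 is k / (1 + k^2). As v \<ge> 0.108, the negative term in v has
        size at least 0.0509, while the remaining terms add up to at most 0.0499.\<close>
      have arith: "x + y + 101 / 100 * z - (7100 / 15041 * v + 7100 / 15041 * z) < 0"
        if "x \<le> 4853 / 100000" "y \<le> 22 / 100000" "z \<le> 1 / 500"
        for x y z :: real using that v(1) by linarith
      have "1 / (1 + v) \<le> 1 / (1108 / 1000)" using v by (intro divide_left_mono) auto
      then have "E * (10 / 9 * (1 / (1 + v) - 1 / 2)) \<le> 1085 / 10000 * (10 / 9 * (1000 / 1108 - 1 / 2))"
        using E v by (intro mult_mono) (auto simp: field_simps)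
      then have "E * (10 / 9 * (1 / (1 + v) - 1 / 2)) \<le> 4853 / 100000" by (rule order_trans) simp
      moreover have "v ^ 3 \<le> (115 / 1000) ^ 3" using v by (intro power_mono) auto
      then have v3: "v ^ 3 \<le> 1 / 500" by (simp add: power3_eq_cube)
      moreover have "E * v ^ 3 \<le> 1085 / 10000 * (1 / 500)" using E v v3 by (intro mult_mono) auto
      then have "E * v ^ 3 \<le> 22 / 100000" by (rule order_trans) simp
      moreover have "(v + v ^ 3) * k / (1 + k\<^sup>2) = 7100 / 15041 * v + 7100 / 15041 * v ^ 3"
        by (simp add: k_def power2_eq_square algebra_simps)
      ultimately show "E * (10 / 9 * (1 / (1 + v) - 1 / 2)) + E * v ^ 3 + 101 / 100 * v ^ 3 - (v + v ^ 3) * k / (1 + k\<^sup>2) < 0"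
        using arith by (simp only:)
    qed simp
    finally show "integral {-1..v} (\<lambda>m. circle_speed m * spiral_boundary k m) < 0" .
  qed (use v in \<open>auto simp: k_def\<close>)
  also have "\<dots> < ereal (5 * pi / 7)" by (simp add: k_def)
  finally show ?thesis .
qed

theorem theorem1p2:
  shows "ereal (7 * pi / 25) < delta1 \<and> delta1 < ereal (5 * pi / 7)"
  using delta1_lower delta1_upper by blast

end
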